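(* Let $n\to\infty$ and let $k=k(n)$ satisfy $1\ll k\ll\sqrt n$. For a positive integer $t$, let $A_1,\dots,A_t$ be drawn uniformly and independently from $\binom{[n]}{k}$ (the $k$-element subsets of $[n]=\{1,\dots,n\}$), and let \[ \zeta=\zeta(n,k,t)=\Pr\bigl(|A_i\cap A_j|\le 1 \text{ for all } i\ne j\bigr). \] (a) There is a fixed $\beta>0$ such that if $t=Dn^2/k^3$ (with $D=D(n)$), then \[ \zeta<\begin{cases}\exp[-\beta D t k] & \text{if } e\ge D=\Omega(1),\\ \exp[-\beta(\log D)tk] & \text{if } D>e.\end{cases} \] (b) If $1\ll t\ll n^2/k^3$, then $\zeta<\exp[-(1-o(1))\,t^2k^4/(4n^2)]$.
   Context: Asymptotic notation refers to $n\to\infty$: $a\ll b$ means $a=o(b)$; $D=\Omega(1)$ means $D$ is bounded below by a positive constant. $\log$ is the natural logarithm and $e$ is Euler's number. A family of sets is called a packing (nearly-disjoint) if no two members share more than one point, so $\zeta$ is the probability that $A_1,\dots,A_t$ form a packing. Statements hold for $n$ sufficiently large. *)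

theory Defs
  imports Complex_Main "HOL-Library.Landau_Symbols" "HOL-Probability.Product_PMF"
begin

definition ksubsets :: "nat \<Rightarrow> nat \<Rightarrow> nat set set" where
  "ksubsets n k = {A. A \<subseteq> {1..n} \<and> card A = k}"

(* The value {} given to Pi_pmf is only the value of the random family outside the
   index set {1..t}.  The definition is meaningful for k <= n only, where ksubsets n k
   is nonempty. *)
definition random_family :: "nat \<Rightarrow> nat \<Rightarrow> nat \<Rightarrow> (nat \<Rightarrow> nat set) pmf" where
  "random_family n k t = Pi_pmf {1..t} {} (\<lambda>_. pmf_of_set (ksubsets n k))"

definition packing :: "'i set \<Rightarrow> ('i \<Rightarrow> 'a set) \<Rightarrow> bool" where
  "packing I A \<longleftrightarrow> (\<forall>i\<in>I. \<forall>j\<in>I. i \<noteq> j \<longrightarrow> card (A i \<inter> A j) \<le> 1)"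

definition zeta :: "nat \<Rightarrow> nat \<Rightarrow> nat \<Rightarrow> real" where
  "zeta n k t = measure_pmf.prob (random_family n k t) {A. packing {1..t} A}"

end

theory Submission
  imports Defs "HOL-Combinatorics.Multiset_Permutations"
begin

text \<open>The sets are exposed one at a time. A new set \<open>A\<close> extends a packing iff it is
  independent in the graph of the pairs already covered, and the product of the conditional
  probabilities is controlled by giving each step a weight that makes the total weight of all
  sequences at most \<open>(n choose k) ^ t\<close>.

  Sparse case: a second-order Bonferroni recursion bounds the number of independent sequences drawn
  with replacement by \<open>n\<^sup>k exp (- (1 - o(1)) e k\<^sup>2 / n\<^sup>2)\<close>, where \<open>e\<close> is the number of
  covered pairs, provided no degree is much larger than \<open>n / k\<close>. With about \<open>i k\<^sup>2 / 2\<close>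
  covered pairs before step \<open>i + 1\<close>, summing over \<open>i\<close> gives \<open>t\<^sup>2 k\<^sup>4 / (4 n\<^sup>2)\<close>.
  Points of large degree are ignored; hitting them often is too unlikely to matter.

  Dense case: a point can be hit only boundedly often while its degree is below a threshold, so most
  sets consist mainly of points of high degree. Expose such a set point by point. As in the
  Kleitman-Winston container method, each new point either removes a fixed proportion of the
  points still allowed, or is confined to a small exceptional set, because a large set of points of
  high degree must, by convexity, contain many covered pairs.\<close>

section \<open>Words and independent sets\<close>

text \<open>Origin of the thresholds. In part (b) the constant 1/4 must come out exactly. A step
  contributes M k^2 / (2 n^2) with an error of 2 k^3 Q / n^3, where M and Q are the sums of the
  degrees and of their squares in the graph of covered pairs. Degrees up to (L + 1) k give Q <= (L +
  1) k M, so the error is a fraction of order L k^2 / n of the main term. Hence L is a small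
  multiple of n / k^2, and points hit more often have to be discarded.

  In part (a) with large D, each point drawn has to gain a power of D. Write D = z^64. The mean
  number of sets through a point is t k / n = D n / k^2, and the threshold m for high degree is
  taken z^16 times smaller. Then at least half of the sets have at least half of their points high,
  and a quarter of the points of such a set lie in exceptional sets of density z^(-16). The powers
  of z are generous and serve only to absorb constants and logarithms. For D > 2k there is no
  packing at all.\<close>

definition words :: "'a set \<Rightarrow> nat \<Rightarrow> 'a list set" where
  "words V k = {xs. set xs \<subseteq> V \<and> length xs = k}"

lemma finite_words: "finite V \<Longrightarrow> finite (words V k)"
  by (simp add: words_def finite_lists_length_eq)

lemma card_words: "finite V \<Longrightarrow> card (words V k) = card V ^ k"
  by (simp add: words_def card_lists_length_eq)

lemma words_0 [simp]: "words V 0 = {[]}"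
  by (auto simp: words_def)

lemma words_Suc: "words V (Suc k) = (\<lambda>(xs, x). x # xs) ` (words V k \<times> V)"
  unfolding words_def by (rule lists_length_Suc_eq)

lemma sum_words_Suc:
  assumes "finite V"
  shows "(\<Sum>xs\<in>words V (Suc k). f xs) = (\<Sum>xs\<in>words V k. \<Sum>x\<in>V. f (x # xs))"
proof -
  have inj: "inj_on (\<lambda>(xs, x). x # xs) (words V k \<times> V)"
    by (auto simp: inj_on_def)
  show ?thesis
    unfolding words_Suc sum.reindex[OF inj]
    by (simp add: sum.cartesian_product case_prod_unfold comp_def)
qed

text \<open>Words grow at the head: the tail of a word is its past.\<close>

primrec weight :: "('a list \<Rightarrow> 'a \<Rightarrow> real) \<Rightarrow> 'a list \<Rightarrow> real" where
  "weight w [] = 1"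
| "weight w (x # xs) = w xs x * weight w xs"

lemma weight_nonneg: "(\<And>xs x. 0 \<le> w xs x) \<Longrightarrow> 0 \<le> weight w xs"
  by (induction xs) auto

text \<open>The bound \<open>C\<close> holds for every past, so weights may adapt to it. If all
  members of a family weigh at least W, the family has at most C^k / W members; this form of
  Markov's inequality is applied both to sequences of sets and to the points of one set.\<close>

lemma sum_weight_le:
  assumes "finite V" and w: "\<And>xs x. 0 \<le> w xs x"
    and C: "\<And>xs. set xs \<subseteq> V \<Longrightarrow> length xs < k \<Longrightarrow> (\<Sum>x\<in>V. w xs x) \<le> C" and "0 \<le> C"
  shows "(\<Sum>xs\<in>words V k. weight w xs) \<le> C ^ k"
  using C
proof (induction k)
  case (Suc k)
  have "(\<Sum>xs\<in>words V (Suc k). weight w xs) = (\<Sum>xs\<in>words V k. (\<Sum>x\<in>V. w xs x) * weight w xs)"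
    by (simp add: sum_words_Suc[OF assms(1)] sum_distrib_right)
  also have "\<dots> \<le> (\<Sum>xs\<in>words V k. C * weight w xs)"
    by (intro sum_mono mult_right_mono Suc.prems weight_nonneg w) (auto simp: words_def)
  also have "\<dots> \<le> C * C ^ k"
    using Suc assms(4) by (simp flip: sum_distrib_left add: mult_left_mono)
  finally show ?case by simp
qed simp

definition del :: "nat \<Rightarrow> 'a list \<Rightarrow> 'a list" where
  "del l xs = take l xs @ drop (Suc l) xs"

lemma sum_list_del:
  fixes f :: "'a \<Rightarrow> real"
  assumes "l < length xs"
  shows "sum_list (map f xs) = f (xs ! l) + sum_list (map f (del l xs))"
proof -
  have "sum_list (map f xs) = sum_list (map f (take l xs @ xs ! l # drop (Suc l) xs))"
    using id_take_nth_drop[OF assms] by simp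
  then show ?thesis by (simp add: del_def)
qed

lemma set_del: "l < length xs \<Longrightarrow> insert (xs ! l) (set (del l xs)) = set xs"
  by (metis Un_insert_right del_def id_take_nth_drop list.simps(15) set_append)

text \<open>Removing the entry at place \<open>l\<close> and inserting an entry there are inverse
  bijections, so the sum is the same for every \<open>l\<close>.\<close>

lemma sum_words_move:
  fixes h :: "'a \<Rightarrow> 'a list \<Rightarrow> real"
  assumes "finite V" and "l \<le> j"
  shows "(\<Sum>xs\<in>words V (Suc j). h (xs ! l) (del l xs)) = (\<Sum>r\<in>words V j. \<Sum>x\<in>V. h x r)"
proof -
  have "(\<Sum>xs\<in>words V (Suc j). h (xs ! l) (del l xs)) = (\<Sum>(r, x)\<in>words V j \<times> V. h x r)"
  proof (rule sum.reindex_bij_witness[where i = "\<lambda>(r, x). take l r @ x # drop l r"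
        and j = "\<lambda>xs. (del l xs, xs ! l)"])
    fix xs assume "xs \<in> words V (Suc j)"
    then have "length xs = Suc j" "set xs \<subseteq> V" by (auto simp: words_def)
    then show "(case (del l xs, xs ! l) of (r, x) \<Rightarrow> take l r @ x # drop l r) = xs"
      "(del l xs, xs ! l) \<in> words V j \<times> V"
      "(case (del l xs, xs ! l) of (r, x) \<Rightarrow> h x r) = h (xs ! l) (del l xs)"
      using assms(2) set_del[of l xs] id_take_nth_drop[of l xs]
      by (auto simp: del_def words_def min_def)
  next
    fix p assume "p \<in> words V j \<times> V"
    then obtain r x where p: "p = (r, x)" "length r = j" "set r \<subseteq> V" "x \<in> V"
      by (auto simp: words_def)
    then show "(del l (case p of (r, x) \<Rightarrow> take l r @ x # drop l r),
          (case p of (r, x) \<Rightarrow> take l r @ x # drop l r) ! l) = p"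
      "(case p of (r, x) \<Rightarrow> take l r @ x # drop l r) \<in> words V (Suc j)"
      using assms(2) set_take_subset[of l r] set_drop_subset[of l r]
      by (auto simp: del_def words_def min_def nth_append)
  qed
  then show ?thesis by (simp add: sum.cartesian_product)
qed

lemma sum_words_del:
  fixes h :: "'a \<Rightarrow> 'a list \<Rightarrow> real"
  assumes "finite V"
  shows "(\<Sum>xs\<in>words V (Suc j). \<Sum>l<Suc j. h (xs ! l) (del l xs))
    = real (Suc j) * (\<Sum>r\<in>words V j. \<Sum>x\<in>V. h x r)"
proof -
  have "(\<Sum>xs\<in>words V (Suc j). \<Sum>l<Suc j. h (xs ! l) (del l xs))
      = (\<Sum>l<Suc j. \<Sum>xs\<in>words V (Suc j). h (xs ! l) (del l xs))"
    by (rule sum.swap)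
  also have "\<dots> = (\<Sum>l<Suc j. \<Sum>r\<in>words V j. \<Sum>x\<in>V. h x r)"
    by (intro sum.cong refl sum_words_move assms) auto
  finally show ?thesis by simp
qed

section \<open>Bonferroni recursion for independent words in a graph\<close>

definition indep :: "('a \<Rightarrow> 'a \<Rightarrow> bool) \<Rightarrow> 'a set \<Rightarrow> bool" where
  "indep E A \<longleftrightarrow> (\<forall>x\<in>A. \<forall>y\<in>A. \<not> E x y)"

locale finite_graph =
  fixes V :: "'a set" and E :: "'a \<Rightarrow> 'a \<Rightarrow> bool"
  assumes finite_V: "finite V"
    and sym: "E x y \<Longrightarrow> E y x"
    and irrefl: "\<not> E x x"
begin

definition e :: "'a \<Rightarrow> 'a \<Rightarrow> real" where "e x y = of_bool (E x y)"
text \<open>Only the set of entries matters, so \<open>I\<close> is invariant under permutations.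
  Since there are no loops, an independent word may repeat a vertex.\<close>

definition I :: "'a list \<Rightarrow> real" where "I xs = of_bool (indep E (set xs))"
definition s :: "nat \<Rightarrow> real" where "s j = (\<Sum>xs\<in>words V j. I xs)"
definition c :: "'a \<Rightarrow> 'a list \<Rightarrow> real" where "c y xs = sum_list (map (\<lambda>x. e x y) xs)"
definition deg :: "'a \<Rightarrow> real" where "deg x = (\<Sum>y\<in>V. e x y)"
text \<open>Twice the number of edges.\<close>

definition M :: real where "M = (\<Sum>x\<in>V. deg x)"
definition Q :: real where "Q = (\<Sum>x\<in>V. deg x ^ 2)"
abbreviation n :: real where "n \<equiv> real (card V)"

lemma e_nonneg: "0 \<le> e x y" by (simp add: e_def)
lemma I_nonneg: "0 \<le> I x" by (simp add: I_def)
lemma e_commute: "e x y = e y x" using sym by (auto simp: e_def)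
lemma deg_nonneg: "0 \<le> deg x" by (simp add: deg_def sum_nonneg e_nonneg)
lemma M_nonneg: "0 \<le> M" by (simp add: M_def sum_nonneg deg_nonneg)
lemma Q_nonneg: "0 \<le> Q" by (simp add: Q_def sum_nonneg)
lemma s_nonneg: "0 \<le> s j" by (simp add: s_def sum_nonneg I_nonneg)

lemma c_nonneg: "0 \<le> c y xs"
  unfolding c_def by (induction xs) (auto simp: e_nonneg)

lemma c_Nat: "\<exists>m::nat. c y xs = real m"
proof (induction xs)
  case (Cons x xs)
  then obtain m where "c y xs = real m" by blast
  then have "c y (x # xs) = real (of_bool (E x y) + m)" by (simp add: c_def e_def)
  then show ?case by blast
qed (simp add: c_def)

lemma I_Cons: "I (x # r) = I r * of_bool (c x r = 0)"
proof -
  have "c x r = 0 \<longleftrightarrow> (\<forall>y\<in>set r. \<not> E y x)"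
    unfolding c_def by (subst sum_list_nonneg_eq_0_iff) (auto simp: e_def)
  then show ?thesis
    using sym irrefl by (auto simp: I_def indep_def)
qed

lemma I_Cons_le: "I (x # r) \<le> I r"
  by (simp add: I_Cons I_nonneg)

lemma I_Cons_ge: "I r * (1 - c x r) \<le> I (x # r)"
proof -
  have "1 - c x r \<le> of_bool (c x r = 0)" using c_Nat[of x r] by auto
  then show ?thesis unfolding I_Cons by (intro mult_left_mono I_nonneg)
qed

text \<open>The second Bonferroni inequality [m = 0] <= 1 - m + (m choose 2), an equality for m up
  to 2.\<close>

lemma I_Cons_Bonferroni: "I (x # r) \<le> I r * (1 - c x r + c x r * (c x r - 1) / 2)"
proof -
  obtain m where m: "c x r = real m" using c_Nat by blast
  have "of_bool (m = 0) \<le> 1 - real m + real m * (real m - 1) / 2"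
  proof (cases "m \<le> 2")
    case True
    then have "m = 0 \<or> m = 1 \<or> m = 2" by auto
    then show ?thesis by auto
  next
    case False
    then have "real m * 2 \<le> real m * (real m - 1)" by (intro mult_left_mono) auto
    then have "0 \<le> 1 - real m + real m * (real m - 1) / 2" by linarith
    then show ?thesis using False by simp
  qed
  then show ?thesis unfolding I_Cons m by (intro mult_left_mono I_nonneg) auto
qed

lemma I_del: "l < length xs \<Longrightarrow> I (xs ! l # del l xs) = I xs"
  using set_del[of l xs] by (simp add: I_def)

text \<open>Each of the j + 1 positions can be moved to the head without changing \<open>I\<close>,
  so all of them contribute equally.\<close>

lemma sum_I_sum_list:
  "(\<Sum>xs\<in>words V (Suc j). I xs * sum_list (map \<phi> xs))
    = real (Suc j) * (\<Sum>r\<in>words V j. \<Sum>x\<in>V. I (x # r) * \<phi> x)"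
proof -
  have "I xs * sum_list (map \<phi> xs) = (\<Sum>l<Suc j. I (xs ! l # del l xs) * \<phi> (xs ! l))"
    if "xs \<in> words V (Suc j)" for xs
    using that I_del[of _ xs]
    by (simp add: words_def sum_list_sum_nth sum_distrib_left atLeast0LessThan del: sum.lessThan_Suc)
  then have "(\<Sum>xs\<in>words V (Suc j). I xs * sum_list (map \<phi> xs))
     = (\<Sum>xs\<in>words V (Suc j). \<Sum>l<Suc j. I (xs ! l # del l xs) * \<phi> (xs ! l))"
    by (rule sum.cong[OF refl])
  also have "\<dots> = real (Suc j) * (\<Sum>r\<in>words V j. \<Sum>x\<in>V. I (x # r) * \<phi> x)"
    by (rule sum_words_del[OF finite_V, where h = "\<lambda>x r. I (x # r) * \<phi> x"])
  finally show ?thesis .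
qed

lemma sum_I_sum_list_le:
  assumes "\<And>x. 0 \<le> \<phi> x"
  shows "(\<Sum>xs\<in>words V j. I xs * sum_list (map \<phi> xs)) \<le> real j * s (j - 1) * (\<Sum>x\<in>V. \<phi> x)"
proof (cases j)
  case (Suc i)
  have "(\<Sum>r\<in>words V i. \<Sum>x\<in>V. I (x # r) * \<phi> x) \<le> (\<Sum>r\<in>words V i. \<Sum>x\<in>V. I r * \<phi> x)"
    by (intro sum_mono mult_right_mono I_Cons_le assms)
  also have "\<dots> = s i * (\<Sum>x\<in>V. \<phi> x)"
    by (simp add: s_def sum_product)
  finally show ?thesis
    unfolding Suc sum_I_sum_list by (simp add: mult.assoc mult_left_mono)
qed (simp add: words_def)

lemma sum_c: "(\<Sum>y\<in>V. c y xs) = sum_list (map deg xs)"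
  by (induction xs) (auto simp: c_def deg_def sum.distrib)

text \<open>First-order Bonferroni at the head. The correction sums \<open>deg x\<close> over the
  entries of r adjacent to x; the function \<open>\<psi>\<close> below regroups it by entries of r,
  and its total over V is \<open>Q\<close>.\<close>

lemma sum_I_deg_ge:
  "real (Suc i) * (s i * M - real i * s (i - 1) * Q)
    \<le> (\<Sum>xs\<in>words V (Suc i). I xs * sum_list (map deg xs))"
proof -
  define \<psi> where "\<psi> z = (\<Sum>x\<in>V. e z x * deg x)" for z
  have \<psi>: "(\<Sum>x\<in>V. c x r * deg x) = sum_list (map \<psi> r)" for r
    by (induction r) (auto simp: c_def \<psi>_def sum.distrib distrib_right)
  have "(\<Sum>z\<in>V. \<psi> z) = (\<Sum>x\<in>V. \<Sum>z\<in>V. e z x * deg x)"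
    unfolding \<psi>_def by (rule sum.swap)
  also have "\<dots> = Q"
    by (simp add: Q_def power2_eq_square deg_def e_commute flip: sum_distrib_right)
  finally have \<psi>Q: "(\<Sum>z\<in>V. \<psi> z) = Q" .
  have "(\<Sum>r\<in>words V i. I r * sum_list (map \<psi> r)) \<le> real i * s (i - 1) * Q"
    unfolding \<psi>Q[symmetric]
    by (rule sum_I_sum_list_le) (simp add: \<psi>_def sum_nonneg e_nonneg deg_nonneg)
  then have "s i * M - real i * s (i - 1) * Q
      \<le> s i * M - (\<Sum>r\<in>words V i. I r * sum_list (map \<psi> r))" by simp
  also have "\<dots> = (\<Sum>r\<in>words V i. \<Sum>x\<in>V. I r * (1 - c x r) * deg x)"
    by (simp add: s_def M_def \<psi>[symmetric] sum_subtractf algebra_simps sum_distrib_left sum_product)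
  also have "\<dots> \<le> (\<Sum>r\<in>words V i. \<Sum>x\<in>V. I (x # r) * deg x)"
    by (intro sum_mono mult_right_mono I_Cons_ge deg_nonneg)
  finally show ?thesis
    unfolding sum_I_sum_list by (simp add: mult_left_mono)
qed

text \<open>c (c - 1) counts ordered pairs of distinct positions whose entries are adjacent to y.
  Removing the two entries one after the other costs a factor \<open>deg y\<close> each and leaves
  an independent word. For j <= 1 the truncated index \<open>j - 2\<close> is harmless because the
  factor in front vanishes.\<close>

lemma sum_I_pairs_le:
  "(\<Sum>r\<in>words V j. I r * (c y r * (c y r - 1))) \<le> real j * real (j - 1) * s (j - 2) * deg y ^ 2"
proof (cases j)
  case (Suc i)
  have "I xs * (c y xs * (c y xs - 1))
      = (\<Sum>l<Suc i. I (xs ! l # del l xs) * (e (xs ! l) y * c y (del l xs)))"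
    if "xs \<in> words V (Suc i)" for xs
  proof -
    have "e (xs ! l) y * (c y xs - 1) = e (xs ! l) y * c y (del l xs)" if "l < length xs" for l
      using sum_list_del[OF that, of "\<lambda>x. e x y"] by (auto simp: c_def e_def)
    moreover have "c y xs = (\<Sum>l<length xs. e (xs ! l) y)"
      by (simp add: c_def sum_list_sum_nth atLeast0LessThan)
    moreover have "c y xs * (c y xs - 1) = (\<Sum>l<length xs. e (xs ! l) y * (c y xs - 1))"
      by (subst calculation(2)) (simp only: sum_distrib_right)
    ultimately have "c y xs * (c y xs - 1) = (\<Sum>l<length xs. e (xs ! l) y * c y (del l xs))"
      by (metis (no_types, lifting) lessThan_iff sum.cong)
    then show ?thesis
      using that I_del[of _ xs] by (simp add: words_def sum_distrib_left del: sum.lessThan_Suc)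
  qed
  then have "(\<Sum>xs\<in>words V j. I xs * (c y xs * (c y xs - 1)))
     = (\<Sum>xs\<in>words V (Suc i). \<Sum>l<Suc i. I (xs ! l # del l xs) * (e (xs ! l) y * c y (del l xs)))"
    unfolding Suc by (rule sum.cong[OF refl])
  also have "\<dots> = real j * (\<Sum>r\<in>words V i. \<Sum>x\<in>V. I (x # r) * (e x y * c y r))"
    unfolding Suc by (rule sum_words_del[OF finite_V, where h = "\<lambda>x r. I (x # r) * (e x y * c y r)"])
  also have "(\<Sum>r\<in>words V i. \<Sum>x\<in>V. I (x # r) * (e x y * c y r))
      \<le> (\<Sum>r\<in>words V i. \<Sum>x\<in>V. I r * (e x y * c y r))"
    by (intro sum_mono mult_right_mono I_Cons_le mult_nonneg_nonneg e_nonneg c_nonneg)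
  also have "\<dots> = (\<Sum>r\<in>words V i. I r * c y r) * deg y"
    unfolding deg_def e_commute[of y] sum_product by (intro sum.cong refl) simp
  also have "\<dots> \<le> (real i * s (i - 1) * deg y) * deg y"
    using sum_I_sum_list_le[of "\<lambda>x. e x y" i] e_nonneg
    by (intro mult_right_mono deg_nonneg) (simp add: c_def deg_def e_commute[of y])
  finally have "(\<Sum>xs\<in>words V j. I xs * (c y xs * (c y xs - 1)))
      \<le> real j * (real i * s (i - 1) * deg y * deg y)"
    by (simp add: mult_left_mono)
  then show ?thesis
    by (simp add: Suc power2_eq_square mult.assoc numeral_2_eq_2)
qed (simp add: words_def c_def)

lemma s_Suc: "s (Suc j) = (\<Sum>r\<in>words V j. \<Sum>y\<in>V. I (y # r))"
  by (simp add: s_def sum_words_Suc[OF finite_V])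

lemma s_0 [simp]: "s 0 = 1" by (simp add: s_def I_def indep_def)

lemma s_Suc_ge: "n * s j - real j * s (j - 1) * M \<le> s (Suc j)"
proof -
  have "(\<Sum>r\<in>words V j. I r * sum_list (map deg r)) \<le> real j * s (j - 1) * M"
    unfolding M_def by (rule sum_I_sum_list_le[OF deg_nonneg])
  then have "n * s j - real j * s (j - 1) * M \<le> n * s j - (\<Sum>r\<in>words V j. I r * sum_list (map deg r))"
    by simp
  also have "\<dots> = (\<Sum>r\<in>words V j. \<Sum>y\<in>V. I r * (1 - c y r))"
    by (simp add: s_def sum_c[symmetric] sum_subtractf algebra_simps sum_distrib_left)
  also have "\<dots> \<le> s (Suc j)"
    unfolding s_Suc by (intro sum_mono I_Cons_ge)
  finally show ?thesis .
qed

lemma s_Suc_le_n: "s (Suc j) \<le> n * s j"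
proof -
  have "s (Suc j) \<le> (\<Sum>r\<in>words V j. \<Sum>y\<in>V. I r)"
    unfolding s_Suc by (intro sum_mono I_Cons_le)
  then show ?thesis by (simp add: s_def sum_distrib_left)
qed

text \<open>The coefficient 3/2 is 1 from the correction in \<open>sum_I_deg_ge\<close> plus 1/2
  from the pair term of Bonferroni.\<close>

lemma s_Suc_le:
  "s (Suc (Suc i)) \<le> n * s (Suc i) - real (Suc i) * s i * M
    + 3 / 2 * real (Suc i) * real i * s (i - 1) * Q"
proof -
  let ?j = "Suc i"
  have "s (Suc ?j) \<le> (\<Sum>r\<in>words V ?j. \<Sum>y\<in>V. I r * (1 - c y r + c y r * (c y r - 1) / 2))"
    unfolding s_Suc[of ?j] by (intro sum_mono I_Cons_Bonferroni)
  also have "\<dots> = (\<Sum>r\<in>words V ?j. \<Sum>y\<in>V. I r - I r * c y r + I r * (c y r * (c y r - 1)) / 2)"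
    by (intro sum.cong refl) (simp add: algebra_simps)
  also have "\<dots> = n * s ?j - (\<Sum>r\<in>words V ?j. I r * sum_list (map deg r))
      + (\<Sum>r\<in>words V ?j. \<Sum>y\<in>V. I r * (c y r * (c y r - 1))) / 2"
    by (simp add: sum.distrib sum_subtractf s_def sum_distrib_left sum_c[symmetric]
        flip: sum_divide_distrib)
  also have "(\<Sum>r\<in>words V ?j. \<Sum>y\<in>V. I r * (c y r * (c y r - 1)))
      \<le> real ?j * real i * s (i - 1) * Q"
    unfolding Q_def sum_distrib_left
    using sum_I_pairs_le[where j = ?j] by (subst sum.swap) (intro sum_mono, simp add: numeral_2_eq_2)
  finally show ?thesis
    using sum_I_deg_ge[of i] by (simp add: field_simps)
qed

text \<open>The Q-term of \<open>s_Suc_le\<close> involves the count two steps back, and this bound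
  carries it forward to \<open>s j\<close>. It proves itself by induction: with the bound for the
  previous step, the first-order loss is at most half of the main term.\<close>

lemma s_Suc_ge_half:
  assumes "real k * M \<le> n ^ 2 / 4" and "0 < n" and "j < k"
  shows "n * s j / 2 \<le> s (Suc j)"
  using assms(3)
proof (induction j)
  case 0
  then show ?case using s_Suc_ge[of 0] assms(2) by simp
next
  case (Suc j)
  have "real (Suc j) * M * s j \<le> real k * M * s j"
    using Suc.prems by (intro mult_right_mono s_nonneg M_nonneg) auto
  also have "\<dots> \<le> n ^ 2 / 4 * s j"
    by (intro mult_right_mono assms s_nonneg)
  also have "\<dots> \<le> n / 2 * s (Suc j)"
    using Suc assms(2) by (simp add: power2_eq_square field_simps)
  finally show ?case
    using s_Suc_ge[of "Suc j"] by (simp add: algebra_simps)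
qed

text \<open>The M-term is brought to \<open>s j\<close> by \<open>s_Suc_le_n\<close>, the Q-term by
  two uses of the halving bound; 6 is 3/2 times 2 * 2.\<close>

lemma s_Suc_le_exp:
  assumes "real k * M \<le> n ^ 2 / 4" and "0 < n" and "j < k"
  shows "s (Suc j) \<le> n * s j * exp (- (real j * M / n ^ 2 - 6 * real j ^ 2 * Q / n ^ 3))"
proof (cases "j = 0")
  case True
  then show ?thesis using s_Suc_le_n[of 0] by simp
next
  case False
  then obtain i where j: "j = Suc i" by (cases j) auto
  have low: "n * (real j * s j * M) \<le> n ^ 2 * (real j * s i * M)"
    using mult_left_mono[OF s_Suc_le_n[of i], of "real j * M * n"] M_nonneg
    by (simp add: j power2_eq_square algebra_simps)
  have "real i * (n ^ 2 * s (i - 1)) \<le> real i * (4 * s j)"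
  proof (cases i)
    case (Suc m)
    have "n * s m / 2 \<le> s i" "n * s i / 2 \<le> s j"
      using s_Suc_ge_half[OF assms(1,2)] assms(3) j Suc by auto
    then have "n * (n * s m / 2) / 2 \<le> s j"
      using mult_left_mono[of "n * s m / 2" "s i" n] by simp
    then show ?thesis using Suc by (simp add: power2_eq_square)
  qed simp
  then have "3 / 2 * real j * Q * (real i * (n ^ 2 * s (i - 1))) \<le> 3 / 2 * real j * Q * (real i * (4 * s j))"
    by (rule mult_left_mono) (simp add: Q_nonneg)
  also have "\<dots> \<le> 6 * real j ^ 2 * Q * s j"
    using mult_mono[of "real i" "real j" "real j * Q * s j" "real j * Q * s j"] Q_nonneg s_nonneg
    by (simp add: j power2_eq_square algebra_simps)
  finally have "n ^ 2 * s (Suc j) \<le> n ^ 3 * s j - n * (real j * s j * M) + 6 * real j ^ 2 * Q * s j"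
    using mult_left_mono[OF s_Suc_le[of i], of "n ^ 2"] low
    by (simp add: j[symmetric] algebra_simps power2_eq_square power3_eq_cube)
  then have "s (Suc j) \<le> (n ^ 3 * s j - n * (real j * s j * M) + 6 * real j ^ 2 * Q * s j) / n ^ 2"
    using assms(2) by (simp add: pos_le_divide_eq mult.commute)
  also have "\<dots> = n * s j * (1 + - (real j * M / n ^ 2 - 6 * real j ^ 2 * Q / n ^ 3))"
    using assms(2) by (simp add: field_simps power2_eq_square power3_eq_cube)
  also have "\<dots> \<le> n * s j * exp (- (real j * M / n ^ 2 - 6 * real j ^ 2 * Q / n ^ 3))"
    by (intro mult_left_mono exp_ge_add_one_self) (simp add: s_nonneg)
  finally show ?thesis .
qed

text \<open>The exponents add up over j < k: the sum of j is k (k - 1) / 2, and 6 times the sum of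
  j^2 is at most 2 k^3.\<close>

lemma s_le_exp:
  assumes "real k * M \<le> n ^ 2 / 4" and "0 < n"
  shows "s k \<le> n ^ k * exp (- (M * (real k * (real k - 1)) / (2 * n ^ 2) - 2 * real k ^ 3 * Q / n ^ 3))"
proof -
  have "s j \<le> n ^ j * exp (- (M * (real j * (real j - 1)) / (2 * n ^ 2) - 2 * real j ^ 3 * Q / n ^ 3))"
    if "j \<le> k" for j
    using that
  proof (induction j)
    case (Suc j)
    let ?a = "M / n ^ 2" and ?b = "Q / n ^ 3"
    have b: "0 \<le> ?b" by (simp add: Q_nonneg)
    have "s (Suc j) \<le> n * s j * exp (- (real j * M / n ^ 2 - 6 * real j ^ 2 * Q / n ^ 3))"
      using s_Suc_le_exp[OF assms] Suc.prems by simp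
    also have "\<dots> \<le> n * (n ^ j * exp (- (M * (real j * (real j - 1)) / (2 * n ^ 2) - 2 * real j ^ 3 * Q / n ^ 3)))
        * exp (- (real j * M / n ^ 2 - 6 * real j ^ 2 * Q / n ^ 3))"
      using Suc by (intro mult_right_mono mult_left_mono) auto
    also have "\<dots> = n ^ Suc j * exp (- (?a * (real j * (real j - 1) / 2 + real j))
        + ?b * (2 * real j ^ 3 + 6 * real j ^ 2))"
      by (simp add: exp_add[symmetric] algebra_simps add_divide_distrib diff_divide_distrib)
    also have "\<dots> \<le> n ^ Suc j * exp (- (?a * (real (Suc j) * (real (Suc j) - 1) / 2))
        + ?b * (2 * real (Suc j) ^ 3))"
    proof -
      have "?a * (real j * (real j - 1) / 2 + real j) = ?a * (real (Suc j) * (real (Suc j) - 1) / 2)"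
        by (simp add: field_simps)
      moreover have "2 * real j ^ 3 + 6 * real j ^ 2 \<le> 2 * real (Suc j) ^ 3"
        by (simp add: power3_eq_cube power2_eq_square algebra_simps)
      then have "?b * (2 * real j ^ 3 + 6 * real j ^ 2) \<le> ?b * (2 * real (Suc j) ^ 3)"
        by (rule mult_left_mono[OF _ b])
      ultimately show ?thesis by (intro mult_left_mono) auto
    qed
    finally show ?case by (simp add: algebra_simps)
  qed simp
  then show ?thesis by simp
qed

end

section \<open>From words with repetitions to k-subsets\<close>

definition ksets :: "'a set \<Rightarrow> nat \<Rightarrow> 'a set set" where
  "ksets V k = {A. A \<subseteq> V \<and> card A = k}"

lemma finite_ksets: "finite V \<Longrightarrow> finite (ksets V k)"
  by (rule finite_subset[of _ "Pow V"]) (auto simp: ksets_def)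

lemma card_ksets: "finite V \<Longrightarrow> card (ksets V k) = card V choose k"
  by (simp add: ksets_def n_subsets)

text \<open>m! times the Stirling number of the second kind. The recursion asks whether the first
  letter of a word occurs again in its tail.\<close>

fun surj_count :: "nat \<Rightarrow> nat \<Rightarrow> nat" where
  "surj_count 0 m = (if m = 0 then 1 else 0)"
| "surj_count (Suc k) 0 = 0"
| "surj_count (Suc k) (Suc m) = Suc m * (surj_count k (Suc m) + surj_count k m)"

lemma card_words_onto:
  "finite B \<Longrightarrow> card {xs. length xs = k \<and> set xs = B} = surj_count k (card B)"
proof (induction k arbitrary: B)
  case 0
  have "{xs :: 'a list. length xs = 0 \<and> set xs = B} = (if B = {} then {[]} else {})" by auto
  then show ?case using 0 by auto
next
  case (Suc k)
  let ?W = "\<lambda>B. {xs. length xs = k \<and> set xs = B}"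
  have fin: "finite (?W C)" if "finite C" for C :: "'a set"
    by (rule finite_subset[OF _ finite_lists_length_eq[OF that, of k]]) auto
  have dec: "{xs. length xs = Suc k \<and> set xs = B}
      = (\<Union>b\<in>B. (#) b ` (?W B \<union> ?W (B - {b})))"
  proof (intro equalityI subsetI)
    fix xs assume "xs \<in> {xs. length xs = Suc k \<and> set xs = B}"
    then obtain b ys where "xs = b # ys" "length ys = k" "insert b (set ys) = B"
      by (auto simp: length_Suc_conv)
    moreover from this have "set ys = B \<or> set ys = B - {b}" by auto
    ultimately show "xs \<in> (\<Union>b\<in>B. (#) b ` (?W B \<union> ?W (B - {b})))" by auto
  next
    fix xs assume "xs \<in> (\<Union>b\<in>B. (#) b ` (?W B \<union> ?W (B - {b})))"
    then obtain b ys where "b \<in> B" "xs = b # ys" "length ys = k" "set ys = B \<or> set ys = B - {b}"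
      by auto
    then show "xs \<in> {xs. length xs = Suc k \<and> set xs = B}"
      by (auto simp only: mem_Collect_eq list.set insert_absorb insert_Diff_single length_Cons)
  qed
  have "card {xs. length xs = Suc k \<and> set xs = B}
      = (\<Sum>b\<in>B. card ((#) b ` (?W B \<union> ?W (B - {b}))))"
    unfolding dec
  proof (rule card_UN_disjoint)
    show "\<forall>b\<in>B. finite ((#) b ` (?W B \<union> ?W (B - {b})))"
      using fin[OF Suc.prems] fin[of "B - {b}" for b] Suc.prems by simp
  qed (use Suc.prems in auto)
  also have "\<dots> = (\<Sum>b\<in>B. surj_count k (card B) + surj_count k (card B - 1))"
  proof (rule sum.cong[OF refl])
    fix b assume b: "b \<in> B"
    have "card ((#) b ` (?W B \<union> ?W (B - {b}))) = card (?W B \<union> ?W (B - {b}))"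
      by (intro card_image) auto
    also have "\<dots> = card (?W B) + card (?W (B - {b}))"
      using b fin[of B] fin[of "B - {b}"] Suc.prems by (intro card_Un_disjoint) auto
    finally show "card ((#) b ` (?W B \<union> ?W (B - {b}))) = surj_count k (card B) + surj_count k (card B - 1)"
      using Suc.IH[of B] Suc.IH[of "B - {b}"] Suc.prems b by simp
  qed
  also have "\<dots> = surj_count (Suc k) (card B)"
    by (cases "card B") auto
  finally show ?case .
qed

lemma surj_count_eq_0: "k < m \<Longrightarrow> surj_count k m = 0"
  by (induction k m rule: surj_count.induct) auto

lemma card_words_by_set:
  assumes "finite V"
  shows "card {xs \<in> words V k. P (set xs)} = (\<Sum>m\<le>card V. card {B \<in> ksets V m. P B} * surj_count k m)"
proof -
  let ?\<P> = "{B. B \<subseteq> V \<and> P B}"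
  have fin: "finite ?\<P>" using assms by simp
  have "card {xs \<in> words V k. P (set xs)} = card (\<Union>B\<in>?\<P>. {xs. length xs = k \<and> set xs = B})"
    by (rule arg_cong[of _ _ card]) (auto simp: words_def)
  also have "\<dots> = (\<Sum>B\<in>?\<P>. card {xs. length xs = k \<and> set xs = B})"
    using fin by (intro card_UN_disjoint)
      (auto intro!: finite_subset[OF _ finite_lists_length_eq[OF assms, of k]])
  also have "\<dots> = (\<Sum>B\<in>?\<P>. surj_count k (card B))"
    using assms by (intro sum.cong refl card_words_onto) (auto intro: finite_subset)
  also have "\<dots> = (\<Sum>m\<le>card V. \<Sum>B | B \<in> ?\<P> \<and> card B = m. surj_count k (card B))"
    using fin assms by (intro sum.group[symmetric]) (auto intro: card_mono)
  also have "\<dots> = (\<Sum>m\<le>card V. card {B \<in> ksets V m. P B} * surj_count k m)"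
    by (intro sum.cong refl) (auto simp: ksets_def intro!: arg_cong[of _ _ card])
  finally show ?thesis .
qed

text \<open>Double counting of pairs (A, x) with x in A: removing x sends them injectively to pairs
  (B, x) with x outside B, and B stays in the down-closed family. So the density of the family does
  not increase from one level to the next.\<close>

lemma LYM_step:
  assumes "finite V" and down: "\<And>A B. P A \<Longrightarrow> B \<subseteq> A \<Longrightarrow> P B" and "m < card V"
  shows "card {B \<in> ksets V (Suc m). P B} * (card V choose m)
    \<le> card {B \<in> ksets V m. P B} * (card V choose Suc m)"
proof -
  let ?F = "\<lambda>m. {B \<in> ksets V m. P B}"
  have fin: "finite (?F m)" for m using finite_ksets[OF assms(1)] by simp
  have finB: "finite B" if "B \<in> ?F m" for B m
    using that assms(1) by (auto simp: ksets_def intro: finite_subset)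
  have "Suc m * card (?F (Suc m)) = (\<Sum>A\<in>?F (Suc m). card A)"
    by (simp add: ksets_def)
  also have "\<dots> = card (SIGMA A:?F (Suc m). A)"
    by (rule card_SigmaI[symmetric]) (use fin finB in blast)+
  also have "\<dots> \<le> card (SIGMA B:?F m. V - B)"
  proof (rule card_inj_on_le[where f = "\<lambda>(A, x). (A - {x}, x)"])
    show "inj_on (\<lambda>(A, x). (A - {x}, x)) (SIGMA A:?F (Suc m). A)"
      by (auto simp: inj_on_def)
    show "(\<lambda>(A, x). (A - {x}, x)) ` (SIGMA A:?F (Suc m). A) \<subseteq> (SIGMA B:?F m. V - B)"
    proof safe
      fix A x assume A: "A \<in> ksets V (Suc m)" "P A" "x \<in> A"
      then have "P (A - {x})" by (intro down[OF A(2)]) auto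
      then show "A - {x} \<in> ksets V m" "P (A - {x})" "x \<in> V" using A by (auto simp: ksets_def)
    qed
    show "finite (SIGMA B:?F m. V - B)" using fin assms(1) by blast
  qed
  also have "\<dots> = card (?F m) * (card V - m)"
  proof -
    have "card (V - B) = card V - m" if "B \<in> ?F m" for B
      using that assms(1) finB[OF that] by (auto simp: ksets_def card_Diff_subset)
    then have "(\<Sum>B\<in>?F m. card (V - B)) = card (?F m) * (card V - m)" by simp
    moreover have "card (SIGMA B:?F m. V - B) = (\<Sum>B\<in>?F m. card (V - B))"
      by (rule card_SigmaI) (use fin assms(1) in blast)+
    ultimately show ?thesis by simp
  qed
  finally have 1: "Suc m * card (?F (Suc m)) \<le> card (?F m) * (card V - m)" .
  have "Suc m * (card (?F (Suc m)) * (card V choose m))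
      \<le> card (?F m) * ((card V - m) * (card V choose m))"
    using mult_le_mono1[OF 1, of "card V choose m"] by (simp only: mult.assoc)
  also have "(card V - m) * (card V choose m) = Suc m * (card V choose Suc m)"
    by (metis binomial_absorb_comp binomial_absorption)
  also have "card (?F m) * (Suc m * (card V choose Suc m)) = Suc m * (card (?F m) * (card V choose Suc m))"
    by (rule mult.left_commute)
  finally show ?thesis by (simp only: Suc_mult_le_cancel1)
qed

lemma LYM:
  assumes "finite V" and down: "\<And>A B. P A \<Longrightarrow> B \<subseteq> A \<Longrightarrow> P B" and "m \<le> k" and "k \<le> card V"
  shows "card {B \<in> ksets V k. P B} * (card V choose m) \<le> card {B \<in> ksets V m. P B} * (card V choose k)"
  using assms(3,4)
proof (induction k rule: dec_induct)
  case (step j)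
  let ?f = "\<lambda>m. card {B \<in> ksets V m. P B}"
  have "(card V choose j) * (?f (Suc j) * (card V choose m))
      \<le> ?f j * (card V choose Suc j) * (card V choose m)"
    using mult_right_mono[of "?f (Suc j) * (card V choose j)" "?f j * (card V choose Suc j)" "card V choose m"]
      LYM_step[where V = V and P = P and m = j, OF assms(1)] down step.prems
    by (simp add: algebra_simps)
  also have "\<dots> \<le> (card V choose j) * (?f m * (card V choose Suc j))"
    using mult_right_mono[OF step.IH, of "card V choose Suc j"] step.prems by (simp add: algebra_simps)
  finally show ?case using step.prems by simp
qed simp

text \<open>Repetitions only make the set of drawn points smaller, so sampling with replacement is at
  least as likely to land in a down-closed family as sampling without.\<close>

lemma card_ksets_le_words:
  assumes "finite V" and down: "\<And>A B. P A \<Longrightarrow> B \<subseteq> A \<Longrightarrow> P B" and "k \<le> card V"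
  shows "card {B \<in> ksets V k. P B} * card V ^ k \<le> card {xs \<in> words V k. P (set xs)} * (card V choose k)"
proof -
  let ?f = "\<lambda>m. card {B \<in> ksets V m. P B}"
  have "card V ^ k = (\<Sum>m\<le>card V. (card V choose m) * surj_count k m)"
    using card_words_by_set[OF assms(1), where k = k and P = "\<lambda>_. True"] assms(1)
    by (simp add: card_words card_ksets)
  then have "?f k * card V ^ k = (\<Sum>m\<le>card V. ?f k * (card V choose m) * surj_count k m)"
    by (simp add: sum_distrib_left algebra_simps)
  also have "\<dots> \<le> (\<Sum>m\<le>card V. ?f m * (card V choose k) * surj_count k m)"
  proof (rule sum_mono)
    fix m
    show "?f k * (card V choose m) * surj_count k m \<le> ?f m * (card V choose k) * surj_count k m"
      using LYM[OF assms(1) down, where m = m and k = k] assms(3) surj_count_eq_0[of k m]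
      by (cases "m \<le> k") (auto intro: mult_right_mono)
  qed
  also have "\<dots> = card {xs \<in> words V k. P (set xs)} * (card V choose k)"
    unfolding card_words_by_set[OF assms(1)] by (simp add: sum_distrib_left sum_distrib_right algebra_simps)
  finally show ?thesis .
qed

context finite_graph
begin

lemma s_eq_card: "s k = real (card {xs \<in> words V k. indep E (set xs)})"
  using finite_words[OF finite_V, of k]
  by (simp add: s_def I_def of_bool_def sum.If_cases Int_def conj_commute)

lemma card_indep_ksets_le:
  assumes "real k * M \<le> n ^ 2 / 4" and "k \<le> card V" and "0 < n"
  shows "real (card {A \<in> ksets V k. indep E A})
    \<le> real (card V choose k)
      * exp (- (M * (real k * (real k - 1)) / (2 * n ^ 2) - 2 * real k ^ 3 * Q / n ^ 3))"
proof -
  have "real (card {A \<in> ksets V k. indep E A} * card V ^ k)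
      \<le> real (card {xs \<in> words V k. indep E (set xs)} * (card V choose k))"
    by (intro of_nat_mono card_ksets_le_words finite_V assms(2)) (auto simp: indep_def)
  also have "\<dots> \<le> n ^ k * exp (- (M * (real k * (real k - 1)) / (2 * n ^ 2) - 2 * real k ^ 3 * Q / n ^ 3))
      * real (card V choose k)"
    using mult_right_mono[OF s_le_exp[OF assms(1,3)]] by (simp add: s_eq_card)
  finally show ?thesis
    using assms(3) by (simp add: field_simps)
qed

end

section \<open>Packings and covered pairs\<close>

abbreviation nearly_disjoint :: "'a set \<Rightarrow> 'a set \<Rightarrow> bool" where
  "nearly_disjoint A B \<equiv> card (A \<inter> B) \<le> 1"

abbreviation packing_list :: "'a set list \<Rightarrow> bool" where
  "packing_list As \<equiv> sorted_wrt nearly_disjoint As"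

definition covered :: "'a set list \<Rightarrow> 'a \<Rightarrow> 'a \<Rightarrow> bool" where
  "covered As x y \<longleftrightarrow> x \<noteq> y \<and> (\<exists>A\<in>set As. x \<in> A \<and> y \<in> A)"

text \<open>The degree in the hypergraph of the sets. For a packing of k-sets the degree in the
  graph of covered pairs is k - 1 times as large, by \<open>card_covered\<close>.\<close>

definition dg :: "'a set list \<Rightarrow> 'a \<Rightarrow> nat" where
  "dg As v = length (filter (\<lambda>A. v \<in> A) As)"

lemma dg_Nil [simp]: "dg [] v = 0"
  and dg_Cons [simp]: "dg (A # As) v = of_bool (v \<in> A) + dg As v"
  by (auto simp: dg_def)

lemma dg_le_length: "dg As v \<le> length As"
  by (simp add: dg_def)

lemma covered_sym: "covered As x y \<Longrightarrow> covered As y x"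
  by (auto simp: covered_def)

lemma nearly_disjointD:
  assumes "nearly_disjoint A B" "finite A" "x \<in> A" "x \<in> B" "y \<in> A" "y \<in> B"
  shows "x = y"
proof (rule ccontr)
  assume "x \<noteq> y"
  then have "2 = card {x, y}" by simp
  also have "\<dots> \<le> card (A \<inter> B)" using assms by (intro card_mono) auto
  finally show False using assms(1) by simp
qed

lemma finite_covered: "\<forall>A\<in>set As. finite A \<Longrightarrow> finite {y. covered As x y}"
  by (rule finite_subset[of _ "\<Union>(set As)"]) (auto simp: covered_def)

text \<open>Two sets of a packing that both contain x share no other point, so the sets
  \<open>A - {x}\<close> are disjoint.\<close>

lemma card_covered:
  assumes "packing_list As" and "\<forall>A\<in>set As. finite A"
  shows "card {y. covered As x y} = sum_list (map (\<lambda>A. if x \<in> A then card A - 1 else 0) As)"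
  using assms
proof (induction As)
  case Nil
  then show ?case by (simp add: covered_def)
next
  case (Cons A As)
  show ?case
  proof (cases "x \<in> A")
    case True
    have "{y. covered (A # As) x y} = (A - {x}) \<union> {y. covered As x y}"
      using True by (auto simp: covered_def)
    moreover have "(A - {x}) \<inter> {y. covered As x y} = {}"
    proof -
      have "y = x" if "y \<in> A" "B \<in> set As" "x \<in> B" "y \<in> B" for y B
        by (rule nearly_disjointD[of A B]) (use that True Cons.prems in auto)
      then show ?thesis by (auto simp: covered_def)
    qed
    ultimately have "card {y. covered (A # As) x y} = card (A - {x}) + card {y. covered As x y}"
      using Cons.prems finite_covered[of As x] by (simp add: card_Un_disjoint)
    then show ?thesis using True Cons by simp
  next
    case False
    then have "{y. covered (A # As) x y} = {y. covered As x y}" by (auto simp: covered_def)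
    then show ?thesis using False Cons by simp
  qed
qed

lemma packing_list_Int: "packing_list As \<Longrightarrow> \<forall>A\<in>set As. finite A \<Longrightarrow> packing_list (map (\<lambda>A. A \<inter> U) As)"
proof (induction As)
  case (Cons A As)
  have "card (A \<inter> U \<inter> (B \<inter> U)) \<le> card (A \<inter> B)" if "B \<in> set As" for B
    using Cons.prems by (intro card_mono) auto
  then show ?case using Cons by fastforce
qed simp

lemma sum_if_mem:
  assumes "finite V"
  shows "(\<Sum>x\<in>V. sum_list (map (\<lambda>A. if x \<in> A then f A else 0) As)) = sum_list (map (\<lambda>A. card (A \<inter> V) * f A) As)"
proof (induction As)
  case (Cons A As)
  have "(\<Sum>x\<in>V. if x \<in> A then f A else 0) = card (A \<inter> V) * f A"
    using assms by (simp add: sum.If_cases Int_commute Collect_mem_eq)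
  then show ?case using Cons by (simp add: sum.distrib)
qed simp

text \<open>The traces of a packing on \<open>U\<close> form a packing again. With \<open>U\<close>
  the whole ground set this gives the number of edges; with \<open>U\<close> a set of stuck points
  it feeds the convexity argument of the dense case.\<close>

lemma sum_card_covered_Int:
  assumes "packing_list As" and "\<forall>A\<in>set As. finite A" and "finite U"
  shows "(\<Sum>x\<in>U. card {y\<in>U. covered As x y}) = sum_list (map (\<lambda>A. card (A \<inter> U) * (card (A \<inter> U) - 1)) As)"
proof -
  let ?Bs = "map (\<lambda>A. A \<inter> U) As"
  have "(\<Sum>x\<in>U. card {y\<in>U. covered As x y}) = (\<Sum>x\<in>U. card {y. covered ?Bs x y})"
    by (intro sum.cong refl arg_cong[of _ _ card]) (auto simp: covered_def)
  also have "\<dots> = (\<Sum>x\<in>U. sum_list (map (\<lambda>B. if x \<in> B then card B - 1 else 0) ?Bs))"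
    using assms by (intro sum.cong refl card_covered packing_list_Int) auto
  also have "\<dots> = sum_list (map (\<lambda>B. card (B \<inter> U) * (card B - 1)) ?Bs)"
    by (rule sum_if_mem[OF assms(3)])
  finally show ?thesis by (simp add: comp_def)
qed

lemma sum_dg:
  assumes "finite U"
  shows "(\<Sum>x\<in>U. dg As x) = sum_list (map (\<lambda>A. card (A \<inter> U)) As)"
proof -
  have "dg As x = sum_list (map (\<lambda>A. if x \<in> A then 1 else 0) As)" for x
    by (induction As) auto
  then show ?thesis using sum_if_mem[OF assms, where f = "\<lambda>_. 1" and As = As] by simp
qed

text \<open>A k-set is spelled by k! words without repetition, and all other words only add to the
  right-hand side. This makes \<open>sum_weight_le\<close> available for a set exposed point by
  point.\<close>

lemma sum_ksets_le_words:
  fixes F :: "'a set \<Rightarrow> real"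
  assumes "finite V" and "\<And>xs. 0 \<le> G xs"
    and "\<And>xs. xs \<in> words V k \<Longrightarrow> distinct xs \<Longrightarrow> F (set xs) \<le> G xs"
  shows "fact k * (\<Sum>A\<in>ksets V k. F A) \<le> (\<Sum>xs\<in>words V k. G xs)"
proof -
  have fin: "finite A" if "A \<in> ksets V k" for A
    using that assms(1) by (auto simp: ksets_def intro: finite_subset)
  have "fact k * (\<Sum>A\<in>ksets V k. F A) = (\<Sum>A\<in>ksets V k. \<Sum>xs\<in>permutations_of_set A. F A)"
    using fin by (simp add: sum_distrib_left ksets_def)
  also have "\<dots> = (\<Sum>A\<in>ksets V k. \<Sum>xs\<in>permutations_of_set A. F (set xs))"
    by (intro sum.cong refl) (auto simp: permutations_of_set_def)
  also have "\<dots> = (\<Sum>xs\<in>(\<Union>A\<in>ksets V k. permutations_of_set A). F (set xs))"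
    using finite_ksets[OF assms(1)]
    by (intro sum.UNION_disjoint[symmetric] ballI finite_permutations_of_set) (auto simp: permutations_of_set_def)
  also have "(\<Union>A\<in>ksets V k. permutations_of_set A) = {xs \<in> words V k. distinct xs}"
    by (auto simp: permutations_of_set_def ksets_def words_def distinct_card)
  also have "(\<Sum>xs\<in>{xs \<in> words V k. distinct xs}. F (set xs)) \<le> (\<Sum>xs\<in>{xs \<in> words V k. distinct xs}. G xs)"
    by (intro sum_mono assms(3)) auto
  also have "\<dots> \<le> (\<Sum>xs\<in>words V k. G xs)"
    by (intro sum_mono2 finite_words assms(1,2)) auto
  finally show ?thesis .
qed

text \<open>The price of allowing repetitions is a factor 2: the falling factorial is at least (n -
  k)^k, which is at least n^k / 2 by Bernoulli.\<close>

lemma power_le_fact_choose: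
  assumes "2 * k ^ 2 \<le> n"
  shows "real n ^ k \<le> 2 * fact k * real (n choose k)"
proof (cases "k = 0")
  case False
  have kn: "k \<le> n" using assms False by (metis le_trans le_square mult_2 power2_eq_square trans_le_add1)
  have n0: "0 < n" using kn False by simp
  have "1 / 2 \<le> 1 + real k * (- (real k / real n))"
    using assms n0 by (simp add: field_simps power2_eq_square flip: of_nat_mult)
  also have "\<dots> \<le> (1 + - (real k / real n)) ^ k"
    using kn n0 by (intro Bernoulli_inequality) (auto simp: field_simps)
  finally have "real n ^ k \<le> 2 * (real n ^ k * (1 - real k / real n) ^ k)"
    using n0 by (simp add: field_simps)
  also have "real n ^ k * (1 - real k / real n) ^ k = (real n - real k) ^ k"
    using n0 by (simp flip: power_mult_distrib add: algebra_simps)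
  also have "\<dots> = (\<Prod>i<k. real n - real k)" by simp
  also have "\<dots> \<le> (\<Prod>i<k. real n - real i)"
    using kn by (intro prod_mono) auto
  also have "\<dots> = fact k * real (n choose k)"
    by (simp add: binomial_gbinomial gbinomial_prod_rev atLeast0LessThan)
  finally show ?thesis by simp
qed (simp)

section \<open>Counting packings, and the link with \<open>zeta\<close>\<close>

definition nb_packings :: "'a set \<Rightarrow> nat \<Rightarrow> nat \<Rightarrow> nat" where
  "nb_packings V k t = card {As \<in> words (ksets V k) t. packing_list As}"

definition packing_ratio :: "nat \<Rightarrow> nat \<Rightarrow> nat \<Rightarrow> real" where
  "packing_ratio n k t = real (nb_packings {1..n} k t) / real (n choose k) ^ t"

lemma nb_packings_Suc_le:
  assumes "finite V"
  shows "nb_packings V k (Suc t) \<le> nb_packings V k t * (card V choose k)"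
proof -
  let ?P = "{As \<in> words (ksets V k) t. packing_list As}"
  have fin: "finite ?P" using finite_words[OF finite_ksets[OF assms]] by simp
  have "nb_packings V k (Suc t) \<le> card ((\<lambda>(As, A). A # As) ` (?P \<times> ksets V k))"
    unfolding nb_packings_def using fin finite_ksets[OF assms]
    by (intro card_mono) (auto simp: words_Suc image_iff)
  also have "\<dots> \<le> card (?P \<times> ksets V k)"
    using fin finite_ksets[OF assms] by (intro card_image_le) auto
  finally show ?thesis by (simp add: nb_packings_def card_cartesian_product card_ksets[OF assms])
qed

lemma packing_ratio_antimono:
  assumes "t \<le> t'"
  shows "packing_ratio n k t' \<le> packing_ratio n k t"
  using assms
proof (induction t' rule: dec_induct)
  case (step t')
  have "real (nb_packings {1..n} k (Suc t')) \<le> real (nb_packings {1..n} k t') * real (n choose k)"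
    using nb_packings_Suc_le[of "{1..n}" k t'] by (metis card_atLeastAtMost diff_Suc_1 finite_atLeastAtMost of_nat_le_iff of_nat_mult)
  then have "packing_ratio n k (Suc t') \<le> packing_ratio n k t'"
    by (cases "(n choose k) = 0") (auto simp: packing_ratio_def field_simps)
  then show ?case using step by simp
qed simp

lemma zeta_le_packing_ratio:
  assumes "k \<le> n"
  shows "zeta n k t \<le> packing_ratio n k t"
proof -
  let ?K = "ksubsets n k"
  have K: "?K = ksets {1..n} k" by (simp add: ksubsets_def ksets_def)
  have fin: "finite ?K" and cardK: "card ?K = n choose k"
    by (simp_all add: K finite_ksets card_ksets)
  have ne: "?K \<noteq> {}" using cardK assms by (metis card.empty less_numeral_extra(3) zero_less_binomial)
  let ?F = "PiE_dflt {1..t} {} (\<lambda>_. ?K)"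
  have finF: "finite ?F" using fin by (intro finite_PiE_dflt) auto
  have cardF: "card ?F = (n choose k) ^ t" by (simp add: card_PiE_dflt fin cardK)
  have neF: "?F \<noteq> {}" using ne by (metis cardF assms card.empty zero_less_binomial less_numeral_extra(3) zero_less_power)
  let ?f = "\<lambda>A :: nat \<Rightarrow> nat set. map A [1..<Suc t]"
  have "random_family n k t = pmf_of_set ?F"
    unfolding random_family_def using fin ne by (intro Pi_pmf_of_set) auto
  then have "zeta n k t = real (card (?F \<inter> {A. packing {1..t} A})) / real (n choose k) ^ t"
    unfolding zeta_def by (simp only: measure_pmf_of_set[OF neF finF] cardF of_nat_power)
  moreover have "card (?F \<inter> {A. packing {1..t} A}) \<le> nb_packings {1..n} k t"
    unfolding nb_packings_def
  proof (rule card_inj_on_le[where f = ?f])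
    show "inj_on ?f (?F \<inter> {A. packing {1..t} A})"
    proof (rule inj_onI)
      fix A B assume *: "A \<in> ?F \<inter> {A. packing {1..t} A}" "B \<in> ?F \<inter> {A. packing {1..t} A}" "?f A = ?f B"
      show "A = B"
      proof
        fix i
        have "\<forall>i\<in>set [1..<Suc t]. A i = B i" using *(3) by (simp only: map_eq_conv)
        \<comment> \<open>Outside {1..t} both families take the default value {}.\<close>
        then show "A i = B i"
          using *(1,2) by (cases "i \<in> {1..t}") (simp_all add: PiE_dflt_def del: upt_Suc)
      qed
    qed
    show "?f ` (?F \<inter> {A. packing {1..t} A}) \<subseteq> {As \<in> words (ksets {1..n} k) t. packing_list As}"
      by (auto simp: PiE_dflt_def words_def K packing_def sorted_wrt_iff_nth_less simp del: upt_Suc)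
    show "finite {As \<in> words (ksets {1..n} k) t. packing_list As}"
      using finite_words[OF finite_ksets, of "{1..n}"] by simp
  qed
  ultimately show ?thesis
    unfolding packing_ratio_def by (simp add: divide_right_mono)
qed

section \<open>The sparse case\<close>

text \<open>Dropping from each set the points whose degree exceeded \<open>L\<close> when the set was drawn
  keeps all degrees below \<open>(L + 1) k\<close>, at the cost of the incidences counted by \<open>excess\<close>.\<close>

fun core :: "real \<Rightarrow> 'a set list \<Rightarrow> 'a set list" where
  "core L [] = []"
| "core L (A # As) = {v \<in> A. real (dg As v) \<le> L} # core L As"

fun excess :: "real \<Rightarrow> 'a set list \<Rightarrow> nat" where
  "excess L [] = 0"
| "excess L (A # As) = card {v \<in> A. L < real (dg As v)} + excess L As"

lemma length_core [simp]: "length (core L As) = length As"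
  by (induction As) auto

lemma core_subset: "B \<in> set (core L As) \<Longrightarrow> \<exists>A\<in>set As. B \<subseteq> A"
  by (induction As) auto

lemma packing_list_core:
  "packing_list As \<Longrightarrow> \<forall>A\<in>set As. finite A \<Longrightarrow> packing_list (core L As)"
proof (induction As)
  case (Cons A As)
  have "card ({v \<in> A. real (dg As v) \<le> L} \<inter> B) \<le> 1" if "B \<in> set (core L As)" for B
  proof -
    obtain C where C: "C \<in> set As" "B \<subseteq> C" using core_subset \<open>B \<in> _\<close> by blast
    have "card ({v \<in> A. real (dg As v) \<le> L} \<inter> B) \<le> card (A \<inter> C)"
      using C Cons.prems by (intro card_mono) auto
    then show ?thesis using Cons.prems C by fastforce
  qed
  then show ?case using Cons by simp
qed simp

lemma dg_core_le_dg: "dg (core L As) v \<le> dg As v"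
  by (induction As) auto

text \<open>When v was last kept, its degree, and hence its degree in the core, was at most
  \<open>L\<close>; the set drawn then adds 1.\<close>

lemma dg_core_le: "0 \<le> L \<Longrightarrow> real (dg (core L As) v) \<le> L + 1"
proof (induction As)
  case (Cons A As)
  have "real (dg (core L As) v) \<le> real (dg As v)" using dg_core_le_dg by simp
  then show ?case using Cons by auto
qed simp

text \<open>A k-set that loses b points loses at most 2 k b of its k (k - 1) ordered pairs.\<close>

lemma core_edges_ge:
  assumes "\<forall>A\<in>set As. finite A \<and> card A = k"
  shows "real (length As) * (real k * (real k - 1)) - 2 * real k * real (excess L As)
    \<le> real (sum_list (map (\<lambda>B. card B * (card B - 1)) (core L As)))"
  using assms
proof (induction As)
  case (Cons A As)
  let ?B = "{v \<in> A. real (dg As v) \<le> L}" and ?H = "{v \<in> A. L < real (dg As v)}"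
  have "card A = card ?B + card ?H"
    using Cons.prems by (subst card_Un_disjoint[symmetric]) (auto intro!: arg_cong[of _ _ card])
  then have k: "real k = real (card ?B) + real (card ?H)" using Cons.prems by simp
  have "real k * (real k - 1) - 2 * real k * real (card ?H) \<le> real (card ?B) * (real (card ?B) - 1)"
    unfolding k by (simp add: algebra_simps)
  also have "\<dots> = real (card ?B * (card ?B - 1))"
    by (cases "card ?B") (auto simp: algebra_simps)
  finally have step: "real k * (real k - 1) - 2 * real k * real (card ?H) \<le> real (card ?B * (card ?B - 1))" .
  have "real (length (A # As)) * (real k * (real k - 1)) - 2 * real k * real (excess L (A # As))
     = (real k * (real k - 1) - 2 * real k * real (card ?H))
       + (real (length As) * (real k * (real k - 1)) - 2 * real k * real (excess L As))"
    by (simp add: algebra_simps)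
  also have "\<dots> \<le> real (card ?B * (card ?B - 1)) + real (sum_list (map (\<lambda>B. card B * (card B - 1)) (core L As)))"
    using step Cons by (intro add_mono) auto
  finally show ?case by simp
qed simp

lemma sum_list_le_length:
  fixes f :: "'b \<Rightarrow> nat"
  shows "(\<And>x. x \<in> set xs \<Longrightarrow> f x \<le> c) \<Longrightarrow> sum_list (map f xs) \<le> length xs * c"
  by (induction xs) (auto intro: add_mono)

text \<open>The exponent of \<open>card_indep_ksets_le\<close> for the graph of the core after i
  sets with excess h, with M >= i k (k - 1) - 2 k h and Q <= (L + 1) t k^3 inserted.\<close>

definition rate :: "nat \<Rightarrow> nat \<Rightarrow> nat \<Rightarrow> real \<Rightarrow> nat \<Rightarrow> real \<Rightarrow> real" where
  "rate n k t L i h = (real i * (real k * (real k - 1)) - 2 * real k * h) * (real k * (real k - 1)) / (2 * real n ^ 2)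
     - 2 * real k ^ 6 * (L + 1) * real t / real n ^ 3"

text \<open>A set extending the packing is independent in the graph of all covered pairs, hence also
  in the subgraph covered by the core. Passing to the subgraph only enlarges the count and caps the
  degrees at (L + 1) k.\<close>

lemma card_extensions_le:
  assumes V: "finite V" "card V = n" and As: "As \<in> words (ksets V k) i" "packing_list As"
    and "i \<le> t" "0 \<le> L" "1 \<le> k" "k \<le> n" and small: "4 * real k ^ 3 * real t \<le> real n ^ 2"
  shows "real (card {A \<in> ksets V k. packing_list (A # As)})
    \<le> real (n choose k) * exp (- rate n k t L i (real (excess L As)))"
proof -
  let ?C = "core L As"
  have As': "length As = i" "\<forall>A\<in>set As. A \<subseteq> V \<and> finite A \<and> card A = k"
    using As V by (auto simp: words_def ksets_def intro: finite_subset)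
  have C: "\<forall>B\<in>set ?C. B \<subseteq> V \<and> finite B \<and> card B \<le> k"
  proof
    fix B assume "B \<in> set ?C"
    then obtain A where "A \<in> set As" "B \<subseteq> A" using core_subset by blast
    then show "B \<subseteq> V \<and> finite B \<and> card B \<le> k"
      using As' by (metis card_mono dual_order.trans finite_subset)
  qed
  have pack: "packing_list ?C" using As(2) As' by (intro packing_list_core) auto
  interpret G: finite_graph V "covered ?C"
    using V(1) by unfold_locales (auto simp: covered_def)
  have cov: "{y \<in> V. covered ?C x y} = {y. covered ?C x y}" for x
    using C by (auto simp: covered_def)
  have deg: "G.deg x = real (card {y. covered ?C x y})" for x
    using V(1) by (simp add: G.deg_def G.e_def of_bool_def sum.If_cases cov Int_def)
  have deg_le: "G.deg x \<le> (L + 1) * real k" for x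
  proof -
    have "sum_list (map (\<lambda>A. if x \<in> A then card A - 1 else 0) Bs) \<le> dg Bs x * k"
      if "\<forall>B\<in>set Bs. card B \<le> k" for Bs
      using that by (induction Bs) (auto intro: add_mono le_trans[OF diff_le_self])
    then have "card {y. covered ?C x y} \<le> dg ?C x * k"
      using card_covered[OF pack] C by simp
    then have "G.deg x \<le> real (dg ?C x) * real k"
      unfolding deg by (metis of_nat_le_iff of_nat_mult)
    also have "\<dots> \<le> (L + 1) * real k"
      using dg_core_le[OF assms(6)] by (intro mult_right_mono) auto
    finally show ?thesis .
  qed
  have M: "G.M = real (sum_list (map (\<lambda>B. card B * (card B - 1)) ?C))"
  proof -
    have "G.M = real (\<Sum>x\<in>V. card {y\<in>V. covered ?C x y})"
      by (simp add: G.M_def deg cov)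
    also have "(\<Sum>x\<in>V. card {y\<in>V. covered ?C x y}) = sum_list (map (\<lambda>B. card (B \<inter> V) * (card (B \<inter> V) - 1)) ?C)"
      using C V by (intro sum_card_covered_Int pack) auto
    also have "\<dots> = sum_list (map (\<lambda>B. card B * (card B - 1)) ?C)"
      using C by (intro arg_cong[of _ _ sum_list] map_cong refl) (simp add: Int_absorb2)
    finally show ?thesis .
  qed
  have M_ge: "real i * (real k * (real k - 1)) - 2 * real k * real (excess L As) \<le> G.M"
    unfolding M using core_edges_ge[of As k L] As' by simp
  have "G.M \<le> real (i * (k * k))"
    unfolding M of_nat_le_iff
    using sum_list_le_length[of ?C "\<lambda>B. card B * (card B - 1)" "k * k"] C As'(1)
    by (simp add: mult_le_mono le_trans[OF diff_le_self])
  also have "\<dots> \<le> real (t * (k * k))" using assms(5) by (intro of_nat_mono mult_right_mono) auto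
  finally have M_le: "G.M \<le> real t * real k ^ 2" by (simp add: power2_eq_square)
  have "G.Q \<le> (\<Sum>x\<in>V. (L + 1) * real k * G.deg x)"
    unfolding G.Q_def power2_eq_square by (intro sum_mono mult_right_mono deg_le G.deg_nonneg)
  also have "\<dots> = (L + 1) * real k * G.M" by (simp add: G.M_def sum_distrib_left)
  also have "\<dots> \<le> (L + 1) * real k * (real t * real k ^ 2)"
    using assms(6) by (intro mult_left_mono M_le) auto
  finally have Q_le: "G.Q \<le> (L + 1) * real t * real k ^ 3"
    by (simp add: power2_eq_square power3_eq_cube algebra_simps)
  have "real k * G.M \<le> real k * (real t * real k ^ 2)" by (intro mult_left_mono M_le) auto
  also have "\<dots> \<le> real (card V) ^ 2 / 4"
    using small V(2) by (simp add: power2_eq_square power3_eq_cube algebra_simps)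
  finally have kM: "real k * G.M \<le> real (card V) ^ 2 / 4" .
  have "{A \<in> ksets V k. packing_list (A # As)} \<subseteq> {A \<in> ksets V k. indep (covered ?C) A}"
  proof safe
    fix A assume A: "A \<in> ksets V k" "packing_list (A # As)"
    then have "finite A" using V(1) by (auto simp: ksets_def intro: finite_subset)
    show "indep (covered ?C) A"
      unfolding indep_def
    proof (intro ballI notI)
      fix x y assume xy: "x \<in> A" "y \<in> A" "covered ?C x y"
      then obtain B where B: "B \<in> set As" "x \<in> B" "y \<in> B"
        unfolding covered_def using core_subset by blast
      have "x = y" by (rule nearly_disjointD[of A B]) (use xy A B \<open>finite A\<close> in auto)
      then show False using xy by (simp add: covered_def)
    qed
  qed
  then have "real (card {A \<in> ksets V k. packing_list (A # As)}) \<le> real (card {A \<in> ksets V k. indep (covered ?C) A})"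
    using finite_ksets[OF V(1)] by (intro of_nat_mono card_mono) auto
  also have "\<dots> \<le> real (card V choose k)
      * exp (- (G.M * (real k * (real k - 1)) / (2 * real (card V) ^ 2) - 2 * real k ^ 3 * G.Q / real (card V) ^ 3))"
    using kM V assms(7,8) by (intro G.card_indep_ksets_le) auto
  also have "\<dots> \<le> real (n choose k) * exp (- rate n k t L i (real (excess L As)))"
  proof -
    have "(real i * (real k * (real k - 1)) - 2 * real k * real (excess L As)) * (real k * (real k - 1)) / (2 * real n ^ 2)
        \<le> G.M * (real k * (real k - 1)) / (2 * real n ^ 2)"
      using assms(7) by (intro divide_right_mono mult_right_mono M_ge) auto
    moreover have "2 * real k ^ 3 * G.Q / real n ^ 3 \<le> 2 * real k ^ 3 * ((L + 1) * real t * real k ^ 3) / real n ^ 3"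
      by (intro divide_right_mono mult_left_mono Q_le) auto
    moreover have "2 * real k ^ 3 * ((L + 1) * real t * real k ^ 3) / real n ^ 3 = 2 * real k ^ 6 * (L + 1) * real t / real n ^ 3"
      by (simp add: algebra_simps flip: power_add)
    ultimately show ?thesis
      unfolding V(2) rate_def by (intro mult_left_mono) auto
  qed
  finally show ?thesis .
qed

text \<open>The weight of a step uses the actual excess of its past, so that every step sums to at
  most n choose k. The cap h enters only in the lower bound for the weight of a complete packing,
  \<open>rate\<close> being decreasing in the excess.\<close>

lemma card_packings_low_excess_le:
  assumes V: "finite V" "card V = n" and "0 \<le> L" "1 \<le> k" "k \<le> n" and small: "4 * real k ^ 3 * real t \<le> real n ^ 2"
  shows "real (card {As \<in> words (ksets V k) t. packing_list As \<and> real (excess L As) \<le> h})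
    \<le> real (n choose k) ^ t * exp (- (\<Sum>i<t. rate n k t L i h))"
proof -
  define w :: "'a set list \<Rightarrow> 'a set \<Rightarrow> real" where
    "w As A = of_bool (packing_list (A # As)) * exp (rate n k t L (length As) (real (excess L As)))" for As A
  have w_nonneg: "0 \<le> w As A" for As A by (simp add: w_def)
  have fin: "finite (ksets V k)" using V(1) by (rule finite_ksets)
  have step: "(\<Sum>A\<in>ksets V k. w As A) \<le> real (n choose k)" if "set As \<subseteq> ksets V k" "length As < t" for As
  proof (cases "packing_list As")
    case True
    have "(\<Sum>A\<in>ksets V k. w As A)
        = real (card {A \<in> ksets V k. packing_list (A # As)}) * exp (rate n k t L (length As) (real (excess L As)))"
      using fin by (simp only: w_def sum_distrib_right[symmetric] sum_of_bool_eq) (simp add: Int_def)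
    also have "\<dots> \<le> real (n choose k) * exp (- rate n k t L (length As) (real (excess L As)))
        * exp (rate n k t L (length As) (real (excess L As)))"
      using that True assms by (intro mult_right_mono card_extensions_le) (auto simp: words_def)
    finally show ?thesis by (simp add: mult.assoc flip: exp_add)
  next
    case False
    then show ?thesis by (simp add: w_def)
  qed
  have anti: "rate n k t L i h \<le> rate n k t L i h'" if "h' \<le> h" for i h'
    unfolding rate_def using that assms(4)
    by (intro diff_right_mono divide_right_mono mult_right_mono diff_left_mono mult_left_mono) auto
  have ge: "exp (\<Sum>i<length As. rate n k t L i h) \<le> weight w As"
    if "packing_list As" "real (excess L As) \<le> h" for As
    using that
  proof (induction As)
    case (Cons A As)
    have "w As A = exp (rate n k t L (length As) (real (excess L As)))"
      using Cons.prems by (simp add: w_def)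
    moreover have "exp (rate n k t L (length As) h) \<le> exp (rate n k t L (length As) (real (excess L As)))"
      using anti Cons.prems by simp
    moreover have "exp (\<Sum>i<length As. rate n k t L i h) \<le> weight w As"
      using Cons by simp
    ultimately have "exp (rate n k t L (length As) h) * exp (\<Sum>i<length As. rate n k t L i h) \<le> w As A * weight w As"
      by (intro mult_mono) auto
    then show ?case by (simp add: exp_add mult.commute)
  qed simp
  let ?P = "{As \<in> words (ksets V k) t. packing_list As \<and> real (excess L As) \<le> h}"
  have "real (card ?P) * exp (\<Sum>i<t. rate n k t L i h) = (\<Sum>As\<in>?P. exp (\<Sum>i<t. rate n k t L i h))" by simp
  also have "\<dots> \<le> (\<Sum>As\<in>?P. weight w As)"
    using ge by (intro sum_mono) (auto simp: words_def)
  also have "\<dots> \<le> (\<Sum>As\<in>words (ksets V k) t. weight w As)"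
    using finite_words[OF fin] by (intro sum_mono2) (auto intro: weight_nonneg w_nonneg)
  also have "\<dots> \<le> real (n choose k) ^ t"
    using step by (intro sum_weight_le fin w_nonneg) auto
  finally show ?thesis
    by (simp add: exp_minus field_simps)
qed

text \<open>An exponential moment of the size of A Int H. Points of \<open>H\<close> weigh x and the
  others 1, in total at most 2n per draw; the last factor 2 comes from
  \<open>power_le_fact_choose\<close>.\<close>

lemma sum_ksets_power_le:
  fixes x :: real
  assumes "finite V" "card V = n" "H \<subseteq> V" "1 \<le> x" "x * real (card H) \<le> real n" "2 * k ^ 2 \<le> n"
  shows "(\<Sum>A\<in>ksets V k. x ^ card (A \<inter> H)) \<le> 2 ^ Suc k * real (n choose k)"
proof -
  define w :: "'a list \<Rightarrow> 'a \<Rightarrow> real" where "w xs v = (if v \<in> H then x else 1)" for xs v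
  have w_nonneg: "0 \<le> w xs v" for xs v using assms(4) by (simp add: w_def)
  have "fact k * (\<Sum>A\<in>ksets V k. x ^ card (A \<inter> H)) \<le> (\<Sum>xs\<in>words V k. weight w xs)"
  proof (rule sum_ksets_le_words[OF assms(1)])
    show "0 \<le> weight w xs" for xs by (intro weight_nonneg w_nonneg)
    show "x ^ card (set xs \<inter> H) \<le> weight w xs" if "distinct xs" for xs
      using that assms(4) by (induction xs) (auto simp: w_def Int_insert_left)
  qed
  also have "\<dots> \<le> (2 * real n) ^ k"
  proof (rule sum_weight_le[OF assms(1) w_nonneg])
    fix xs
    have "(\<Sum>v\<in>V. w xs v) = x * real (card H) + real (card (V - H))"
      unfolding w_def using assms(1,3) by (simp add: sum.If_cases Int_absorb1 Diff_eq)
    also have "\<dots> \<le> real n + real n"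
      using assms(2,5) card_mono[OF assms(1), of "V - H"] by (intro add_mono) auto
    finally show "(\<Sum>v\<in>V. w xs v) \<le> 2 * real n" by simp
  qed simp
  also have "\<dots> = 2 ^ k * real n ^ k" by (simp add: power_mult_distrib)
  also have "\<dots> \<le> 2 ^ k * (2 * fact k * real (n choose k))"
    by (intro mult_left_mono power_le_fact_choose assms(6)) simp
  finally have "fact k * (\<Sum>A\<in>ksets V k. x ^ card (A \<inter> H)) \<le> fact k * (2 ^ Suc k * real (n choose k))"
    by (simp add: algebra_simps)
  then show ?thesis by simp
qed

text \<open>At most t k / L points have degree above \<open>L\<close>, and x is the base for which
  this yields x * card H <= n. All sequences are counted here, whether packings or not.\<close>

lemma card_high_excess_le:
  fixes L h :: real
  assumes V: "finite V" "card V = n" and "0 < L" "2 * k ^ 2 \<le> n" "1 \<le> k" "1 \<le> t"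
    and x: "x = L * real n / (real k * real t)" "1 \<le> x"
  shows "real (card {As \<in> words (ksets V k) t. h \<le> real (excess L As)}) * x powr h
    \<le> (2 ^ Suc k * real (n choose k)) ^ t"
proof -
  define w :: "'a set list \<Rightarrow> 'a set \<Rightarrow> real" where
    "w As A = x ^ card {v \<in> A. L < real (dg As v)}" for As A
  have w_nonneg: "0 \<le> w As A" for As A using x(2) by (simp add: w_def)
  have fin: "finite (ksets V k)" using V(1) by (rule finite_ksets)
  have step: "(\<Sum>A\<in>ksets V k. w As A) \<le> 2 ^ Suc k * real (n choose k)"
    if "set As \<subseteq> ksets V k" "length As < t" for As
  proof -
    let ?H = "{v \<in> V. L < real (dg As v)}"
    have "L * real (card ?H) = (\<Sum>v\<in>?H. L)" by simp
    also have "\<dots> \<le> (\<Sum>v\<in>?H. real (dg As v))" by (intro sum_mono) auto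
    also have "\<dots> \<le> (\<Sum>v\<in>V. real (dg As v))" using V(1) by (intro sum_mono2) auto
    also have "\<dots> = real (sum_list (map (\<lambda>A. card (A \<inter> V)) As))" by (simp flip: sum_dg[OF V(1)])
    also have "\<dots> \<le> real (length As * k)"
      using that V(1) by (intro of_nat_mono sum_list_le_length) (auto simp: ksets_def Int_absorb2)
    also have "\<dots> \<le> real t * real k" using that by (simp add: mult_right_mono)
    finally have "L * real (card ?H) \<le> real t * real k" .
    then have "real n * (L * real (card ?H)) \<le> real n * (real t * real k)" by (intro mult_left_mono) auto
    then have "x * real (card ?H) \<le> real n"
      unfolding x(1) using assms(5,6) by (simp add: field_simps)
    then have "(\<Sum>A\<in>ksets V k. x ^ card (A \<inter> ?H)) \<le> 2 ^ Suc k * real (n choose k)"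
      by (intro sum_ksets_power_le V x(2) assms(4)) auto
    moreover have "w As A = x ^ card (A \<inter> ?H)" if "A \<in> ksets V k" for A
      unfolding w_def using that by (auto simp: ksets_def intro!: arg_cong[of _ _ "\<lambda>B. x ^ card B"])
    ultimately show ?thesis by simp
  qed
  have w_eq: "weight w As = x ^ excess L As" for As
    by (induction As) (auto simp: w_def power_add)
  let ?P = "{As \<in> words (ksets V k) t. h \<le> real (excess L As)}"
  have "real (card ?P) * x powr h = (\<Sum>As\<in>?P. x powr h)" by simp
  also have "\<dots> \<le> (\<Sum>As\<in>?P. weight w As)"
  proof (rule sum_mono)
    fix As assume "As \<in> ?P"
    then have "x powr h \<le> x powr real (excess L As)" using x(2) by (intro powr_mono) auto
    then show "x powr h \<le> weight w As" using x(2) by (simp add: w_eq powr_realpow)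
  qed
  also have "\<dots> \<le> (\<Sum>As\<in>words (ksets V k) t. weight w As)"
    using finite_words[OF fin] by (intro sum_mono2) (auto intro: weight_nonneg w_nonneg)
  also have "\<dots> \<le> (2 ^ Suc k * real (n choose k)) ^ t"
    using step by (intro sum_weight_le fin w_nonneg) auto
  finally show ?thesis .
qed

lemma excess_eq_0:
  "real (length As) \<le> L \<Longrightarrow> excess L As = 0"
proof (induction As)
  case (Cons A As)
  have "real (dg As v) \<le> L" for v
    using dg_le_length[of As v] Cons.prems by (simp add: order_trans[of _ "real (length As)"])
  then have "{v \<in> A. L < real (dg As v)} = {}" by (auto simp: not_less)
  moreover have "excess L As = 0" using Cons by simp
  ultimately show ?case by (simp only: excess.simps card.empty)
qed simp

lemma sum_rate:
  assumes "1 \<le> t"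
  shows "(\<Sum>i<t. rate n k t L i h)
    = real t * (real t - 1) * (real k * (real k - 1)) ^ 2 / (4 * real n ^ 2)
      - real t * real k * h * (real k * (real k - 1)) / real n ^ 2
      - 2 * real t ^ 2 * real k ^ 6 * (L + 1) / real n ^ 3"
proof -
  have gauss: "(\<Sum>i<t. real i) = real t * (real t - 1) / 2"
    by (induction t) (auto simp: field_simps)
  have "(\<Sum>i<t. rate n k t L i h) = (\<Sum>i<t. real i) * ((real k * (real k - 1)) ^ 2 / (2 * real n ^ 2))
      - real t * (2 * real k * h * (real k * (real k - 1)) / (2 * real n ^ 2))
      - real t * (2 * real k ^ 6 * (L + 1) * real t / real n ^ 3)"
    unfolding sum_distrib_right rate_def
    by (simp add: sum_subtractf left_diff_distrib diff_divide_distrib power2_eq_square mult.assoc)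
  moreover have "2 * real k * h * (real k * (real k - 1)) / (2 * real n ^ 2) = real k * h * (real k * (real k - 1)) / real n ^ 2"
    by simp
  ultimately show ?thesis unfolding gauss
    by (simp add: power2_eq_square mult_ac del: right_diff_distrib_numeral left_diff_distrib_numeral)
qed

text \<open>Take \<open>L = \<epsilon> n / k\<^sup>2\<close>. If \<open>t \<le> L\<close> there is no excess. Otherwise
  points of degree above \<open>L\<close> are so rare that the excess exceeds \<open>\<epsilon> t k\<close> only with
  probability \<open>exp (- t k)\<close>, which is negligible because the exponent
  \<open>t\<^sup>2 k\<^sup>4 / (4 n\<^sup>2)\<close> is then bounded below.\<close>

lemma packing_ratio_le:
  fixes \<epsilon> :: real
  assumes \<epsilon>: "0 < \<epsilon>" "\<epsilon> \<le> 1" and t: "1 / \<epsilon> \<le> real t" and k8: "8 / \<epsilon> ^ 3 \<le> real k"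
    and n: "2 * k ^ 2 \<le> n" "real k ^ 2 \<le> \<epsilon> * real n"
    and small: "real t * real k ^ 3 \<le> \<epsilon> / (4 * exp 1) powr (1 / \<epsilon>) * real n ^ 2"
  shows "packing_ratio n k t \<le> exp (- ((1 - 24 * \<epsilon>) * (real t ^ 2 * real k ^ 4 / (4 * real n ^ 2))))"
proof -
  define X where "X = real t ^ 2 * real k ^ 4 / (4 * real n ^ 2)"
  define L where "L = \<epsilon> * real n / real k ^ 2"
  define h where "h = \<epsilon> * real t * real k"
  define \<Theta> where "\<Theta> = (\<Sum>i<t. rate n k t L i h)"
  let ?V = "{1..n}" and ?N = "real (n choose k)"
  have k: "1 / \<epsilon> \<le> real k"
  proof -
    have "\<epsilon> ^ 3 \<le> \<epsilon> ^ 1" using \<epsilon> by (intro power_decreasing) auto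
    then have "1 / \<epsilon> \<le> 8 / \<epsilon> ^ 3" using \<epsilon> by (intro frac_le) auto
    then show ?thesis using k8 by linarith
  qed
  \<comment> \<open>The number \<epsilon>^3 / 4 is the lower bound for \<epsilon> X that will be
    available when t > L.\<close>
  have k_large: "exp (- (real k / 2)) \<le> \<epsilon> ^ 3 / 4"
  proof -
    have "4 / \<epsilon> ^ 3 \<le> exp (real k / 2)"
      using k8 exp_ge_add_one_self[of "real k / 2"] by (simp add: field_simps)
    then show ?thesis using \<epsilon> by (simp add: exp_minus field_simps)
  qed
  have ge1: "1 \<le> real t" "1 \<le> real k"
  proof -
    have "1 \<le> 1 / \<epsilon>" using \<epsilon> by simp
    then show "1 \<le> real t" "1 \<le> real k" using t k by linarith+
  qed
  then have t1: "1 \<le> t" and k1: "1 \<le> k" by auto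
  have kn: "k \<le> n"
    using n(1) by (metis le_trans le_square mult_2 power2_eq_square trans_le_add1)
  have n0: "0 < n" using kn k1 by simp
  have N0: "0 < ?N" using kn by simp
  have L1: "1 \<le> L" using n(2) ge1 by (simp add: L_def pos_le_divide_eq)
  have X0: "0 < X" using ge1 n0 by (simp add: X_def)
  have pe: "4 powr 1 \<le> (4 * exp 1 :: real) powr (1 / \<epsilon>)"
  proof -
    have "(4 :: real) \<le> 4 * exp 1" by simp
    moreover from this have "1 \<le> 4 * exp (1 :: real)" by linarith
    ultimately have "4 \<le> 4 * exp (1 :: real)" "1 \<le> 4 * exp (1 :: real)"
      by auto
    then show ?thesis
      using \<epsilon> powr_mono[of 1 "1 / \<epsilon>" "4 * exp 1"] by (simp del: one_le_exp_iff exp_le_cancel_iff)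
  qed
  have small4: "4 * real k ^ 3 * real t \<le> real n ^ 2"
  proof -
    have "\<epsilon> / (4 * exp 1) powr (1 / \<epsilon>) \<le> 1 / 4"
      using pe \<epsilon> by (intro frac_le) auto
    then have "\<epsilon> / (4 * exp 1) powr (1 / \<epsilon>) * real n ^ 2 \<le> 1 / 4 * real n ^ 2"
      by (intro mult_right_mono) auto
    then have "real t * real k ^ 3 \<le> 1 / 4 * real n ^ 2" using small by linarith
    then show ?thesis by (simp add: mult.commute)
  qed
  \<comment> \<open>23 = 3 + 4 + 16: the first from replacing t - 1 and (k - 1)^2 by t and k^2, the
    second from the excess h, the third from the Q-term with L + 1 <= 2 L.\<close>
  have \<Theta>: "(1 - 23 * \<epsilon>) * X \<le> \<Theta>"
  proof -
    have "(1 - 3 * \<epsilon>) * X \<le> real t * (real t - 1) * (real k * (real k - 1)) ^ 2 / (4 * real n ^ 2)"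
    proof -
      have a: "1 - \<epsilon> \<le> 1 - 1 / real t" "1 - \<epsilon> \<le> 1 - 1 / real k"
        using t k \<epsilon> ge1 by (simp_all add: field_simps)
      have "1 - 3 * \<epsilon> \<le> (1 - \<epsilon>) * (1 - \<epsilon>) ^ 2"
        using \<epsilon> by (simp add: power2_eq_square algebra_simps)
      also have "\<dots> \<le> (1 - 1 / real t) * (1 - 1 / real k) ^ 2"
        using a \<epsilon> ge1 by (intro mult_mono power_mono) auto
      finally have "(1 - 3 * \<epsilon>) * X \<le> (1 - 1 / real t) * (1 - 1 / real k) ^ 2 * X"
        using X0 by (intro mult_right_mono) auto
      also have "\<dots> = real t * (real t - 1) * (real k * (real k - 1)) ^ 2 / (4 * real n ^ 2)"
        using ge1 n0 by (simp add: X_def field_simps power2_eq_square eval_nat_numeral)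
      finally show ?thesis .
    qed
    moreover have "real t * real k * h * (real k * (real k - 1)) / real n ^ 2 \<le> 4 * \<epsilon> * X"
    proof -
      have "real t * real k * h * (real k * (real k - 1)) \<le> real t * real k * h * (real k * real k)"
        using \<epsilon> by (intro mult_left_mono) (auto simp: h_def)
      then have "real t * real k * h * (real k * (real k - 1)) / real n ^ 2 \<le> real t * real k * h * (real k * real k) / real n ^ 2"
        by (rule divide_right_mono) simp
      also have "\<dots> = 4 * \<epsilon> * X"
        by (simp add: X_def h_def power2_eq_square eval_nat_numeral)
      finally show ?thesis .
    qed
    moreover have "2 * real t ^ 2 * real k ^ 6 * (L + 1) / real n ^ 3 \<le> 16 * \<epsilon> * X"
    proof -
      have "2 * real t ^ 2 * real k ^ 6 * (L + 1) / real n ^ 3 \<le> 2 * real t ^ 2 * real k ^ 6 * (2 * L) / real n ^ 3"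
        using L1 by (intro divide_right_mono mult_left_mono) auto
      also have "\<dots> = 16 * \<epsilon> * X"
        using ge1 n0 by (simp add: X_def L_def field_simps eval_nat_numeral)
      finally show ?thesis .
    qed
    ultimately show ?thesis
      unfolding \<Theta>_def sum_rate[OF t1] by (simp add: algebra_simps)
  qed
  let ?low = "{As \<in> words (ksets ?V k) t. packing_list As \<and> real (excess L As) \<le> h}"
  let ?high = "{As \<in> words (ksets ?V k) t. h \<le> real (excess L As)}"
  have fin: "finite (words (ksets ?V k) t)" by (intro finite_words finite_ksets) simp
  have low: "real (card ?low) \<le> ?N ^ t * exp (- ((1 - 23 * \<epsilon>) * X))"
  proof -
    have "real (card ?low) \<le> ?N ^ t * exp (- \<Theta>)"
      unfolding \<Theta>_def using L1 k1 kn small4 by (intro card_packings_low_excess_le) auto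
    also have "\<dots> \<le> ?N ^ t * exp (- ((1 - 23 * \<epsilon>) * X))"
      using \<Theta> by (intro mult_left_mono) auto
    finally show ?thesis .
  qed
  have "real (nb_packings ?V k t) \<le> ?N ^ t * exp (- ((1 - 24 * \<epsilon>) * X))"
  proof (cases "real t \<le> L")
    case True
    have "finite ?low" using fin by simp
    then have "nb_packings ?V k t \<le> card ?low"
      unfolding nb_packings_def using True \<epsilon>
      by (intro card_mono) (auto simp: words_def excess_eq_0 h_def)
    then have "real (nb_packings ?V k t) \<le> ?N ^ t * exp (- ((1 - 23 * \<epsilon>) * X))"
      using low by linarith
    also have "\<dots> \<le> ?N ^ t * exp (- ((1 - 24 * \<epsilon>) * X))"
      using X0 \<epsilon> by (intro mult_left_mono) auto
    finally show ?thesis .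
  next
    case False
    define x where "x = L * real n / (real k * real t)"
    have tk3: "0 < real t * real k ^ 3" using ge1 by simp
    \<comment> \<open>This explains the constant in the hypothesis \<open>small\<close>: x^h is then
      at least (4 e)^(t k), where 4^(t k) pays for the factors 2^(k + 1) of
      \<open>card_high_excess_le\<close> and e^(t k) is the gain.\<close>
    have "(4 * exp 1) powr (1 / \<epsilon>) \<le> \<epsilon> * real n ^ 2 / (real t * real k ^ 3)"
      using small tk3 by (simp add: field_simps)
    also have "\<dots> = x" using ge1 by (simp add: x_def L_def field_simps eval_nat_numeral)
    finally have x: "(4 * exp 1) powr (1 / \<epsilon>) \<le> x" .
    then have x1: "1 \<le> x" using pe by simp
    have "((4 * exp 1) powr (1 / \<epsilon>)) powr h \<le> x powr h"
      using x \<epsilon> by (intro powr_mono2) (auto simp: h_def)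
    then have xh: "(4 * exp 1) powr (real t * real k) \<le> x powr h"
      using \<epsilon> by (simp add: powr_powr h_def mult.assoc)
    have "(2 ^ Suc k * ?N) ^ t \<le> ?N ^ t * 4 ^ (t * k)"
    proof -
      have "(2 :: real) ^ Suc k \<le> 2 ^ (2 * k)" using k1 by (intro power_increasing) auto
      also have "\<dots> = 4 ^ k" by (simp add: power_mult)
      finally have "(2 ^ Suc k * ?N) ^ t \<le> (4 ^ k * ?N) ^ t"
        by (intro power_mono mult_right_mono) auto
      also have "\<dots> = ?N ^ t * 4 ^ (t * k)"
        by (simp add: power_mult_distrib power_mult[symmetric] mult.commute)
      finally show ?thesis .
    qed
    moreover have "real (card ?high) * x powr h \<le> (2 ^ Suc k * ?N) ^ t"
      using L1 n k1 t1 x1 by (intro card_high_excess_le[OF _ _ _ _ _ _ x_def]) auto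
    moreover have "real (card ?high) * (4 * exp 1) powr (real t * real k) \<le> real (card ?high) * x powr h"
      by (intro mult_left_mono xh) simp
    ultimately have "real (card ?high) * (4 * exp 1) powr (real t * real k) \<le> ?N ^ t * 4 ^ (t * k)"
      by linarith
    moreover have "(4 * exp 1) powr (real t * real k) = 4 ^ (t * k) * exp (real t * real k)"
      by (simp add: powr_mult exp_powr_real flip: powr_realpow of_nat_mult)
    ultimately have "real (card ?high) * exp (real t * real k) \<le> ?N ^ t"
      by (simp add: algebra_simps)
    then have high: "real (card ?high) \<le> ?N ^ t * exp (- (real t * real k))"
      by (simp add: exp_minus field_simps)
    have "\<epsilon> ^ 2 / 4 \<le> X"
    proof -
      have "\<epsilon> \<le> real t * real k ^ 2 / real n"
        using False ge1 n0 by (simp add: L_def field_simps)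
      then have "\<epsilon> ^ 2 \<le> (real t * real k ^ 2 / real n) ^ 2"
        using \<epsilon> by (intro power_mono) auto
      also have "\<dots> = 4 * X" by (simp add: X_def power_divide power_mult_distrib flip: power_mult)
      finally show ?thesis by simp
    qed
    then have X_ge: "\<epsilon> * (\<epsilon> ^ 2 / 4) \<le> \<epsilon> * X" using \<epsilon> by (intro mult_left_mono) auto
    have "X = (real t * real k) * (real k ^ 3 * real t) / (4 * real n ^ 2)"
      by (simp add: X_def eval_nat_numeral)
    also have "\<dots> \<le> (real t * real k) * (real n ^ 2 / 4) / (4 * real n ^ 2)"
      using small4 by (intro divide_right_mono mult_left_mono) auto
    also have "\<dots> \<le> real t * real k / 2" using n0 by (simp add: field_simps)
    finally have X_le: "X \<le> real t * real k / 2" .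
    have "exp (- (real t * real k)) \<le> exp (- X) * exp (- (real k / 2))"
    proof -
      have "real k \<le> real t * real k" using ge1 by (simp add: mult_le_cancel_right1)
      then show ?thesis using X_le by (simp flip: exp_add)
    qed
    also have "\<dots> \<le> exp (- X) * (\<epsilon> * X)"
    proof -
      have "exp (- (real k / 2)) \<le> \<epsilon> * X" using k_large X_ge by (simp add: eval_nat_numeral)
      then show ?thesis by (intro mult_left_mono) auto
    qed
    \<comment> \<open>The high-excess sequences must fit into the gap between the bounds with 23 and
      24 in the exponent, so that the two counts add up to the bound with 24.\<close>
    also have "\<dots> \<le> exp (- ((1 - 23 * \<epsilon>) * X)) * (exp (\<epsilon> * X) - 1)"
    proof (rule mult_mono)
      show "\<epsilon> * X \<le> exp (\<epsilon> * X) - 1" using exp_ge_add_one_self[of "\<epsilon> * X"] by linarith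
    qed (use \<epsilon> X0 in \<open>auto simp: algebra_simps\<close>)
    also have "\<dots> = exp (- ((1 - 24 * \<epsilon>) * X)) - exp (- ((1 - 23 * \<epsilon>) * X))"
      by (simp add: algebra_simps flip: exp_add)
    finally have "exp (- (real t * real k)) \<le> exp (- ((1 - 24 * \<epsilon>) * X)) - exp (- ((1 - 23 * \<epsilon>) * X))" .
    then have "?N ^ t * exp (- (real t * real k))
        \<le> ?N ^ t * (exp (- ((1 - 24 * \<epsilon>) * X)) - exp (- ((1 - 23 * \<epsilon>) * X)))"
      by (rule mult_left_mono) simp
    then have "real (card ?high) \<le> ?N ^ t * exp (- ((1 - 24 * \<epsilon>) * X)) - ?N ^ t * exp (- ((1 - 23 * \<epsilon>) * X))"
      using high by (simp add: right_diff_distrib)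
    moreover have "nb_packings ?V k t \<le> card (?low \<union> ?high)"
      unfolding nb_packings_def using fin by (intro card_mono) auto
    then have "nb_packings ?V k t \<le> card ?low + card ?high"
      using card_Un_le[of ?low ?high] by linarith
    ultimately show ?thesis using low by linarith
  qed
  then show ?thesis
    using N0 by (simp add: packing_ratio_def X_def[symmetric] field_simps)
qed

section \<open>The dense case\<close>

definition allowed :: "'a set \<Rightarrow> 'a set list \<Rightarrow> 'a list \<Rightarrow> 'a set" where
  "allowed V As xs = {v \<in> V. \<forall>x\<in>set xs. \<not> covered As x v}"

lemma allowed_Nil [simp]: "allowed V As [] = V"
  and allowed_Cons: "allowed V As (x # xs) = allowed V As xs - {y \<in> allowed V As xs. covered As x y}"
  by (auto simp: allowed_def)

text \<open>The two ways in which a high point can fail to shrink the allowed set are put into one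
  predicate, because either way such points number at most \<rho> times \<open>card V\<close>,
  whatever the past.\<close>

definition stuck :: "'a set \<Rightarrow> nat \<Rightarrow> 'a set list \<Rightarrow> real \<Rightarrow> real \<Rightarrow> real \<Rightarrow> 'a list \<Rightarrow> 'a \<Rightarrow> bool" where
  "stuck V k As m \<rho> c xs v \<longleftrightarrow> v \<in> allowed V As xs \<and> m < real (dg As v) \<and>
     (real (card (allowed V As xs)) \<le> \<rho> * real (card V) \<or>
      real (card {y \<in> allowed V As xs. covered As v y}) < c * real (card (allowed V As xs)) / real k)"

text \<open>The square lies above its tangent at a. With a the mean of f this is the Cauchy-Schwarz
  inequality.\<close>

lemma sum_list_tangent:
  fixes a :: real and f :: "'b \<Rightarrow> nat"
  shows "(2 * a - 1) * real (sum_list (map f xs)) - a ^ 2 * real (length xs)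
    \<le> real (sum_list (map (\<lambda>x. f x * (f x - 1)) xs))"
proof (induction xs)
  case (Cons x xs)
  have "real (f x * (f x - 1)) = real (f x) ^ 2 - real (f x)"
    by (cases "f x") (auto simp: power2_eq_square algebra_simps)
  moreover have "0 \<le> (real (f x) - a) ^ 2" by simp
  ultimately have "(2 * a - 1) * real (f x) - a ^ 2 \<le> real (f x * (f x - 1))"
    by (simp add: power2_eq_square algebra_simps)
  then show ?case using Cons by (simp add: algebra_simps del: of_nat_mult)
qed simp

text \<open>While many points are allowed, a stuck point has few covered neighbours among the stuck
  points. But these have at least m incidences each, spread over at most t sets, and by convexity
  this forces many covered pairs among them unless they are few.\<close>

lemma card_stuck_le:
  assumes V: "finite V" and As: "packing_list As" "\<forall>A\<in>set As. A \<subseteq> V" "length As \<le> t"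
    and pos: "0 < m" "0 < c" "1 \<le> k" "1 \<le> t"
    and H1: "2 * real t \<le> m * \<rho> * real (card V)" and H2: "2 * real t * c \<le> \<rho> * real k * m ^ 2"
  shows "real (card {v \<in> V. stuck V k As m \<rho> c xs v}) \<le> \<rho> * real (card V)"
proof -
  let ?R = "allowed V As xs" and ?n = "real (card V)"
  have R: "?R \<subseteq> V" "finite ?R" using V by (auto simp: allowed_def)
  define U where "U = {v \<in> V. stuck V k As m \<rho> c xs v}"
  have U: "U \<subseteq> ?R" "finite U" using V by (auto simp: U_def stuck_def)
  have finA: "\<forall>A\<in>set As. finite A" using As(2) V by (auto intro: finite_subset)
  show ?thesis
  proof (cases "real (card ?R) \<le> \<rho> * ?n")
    case True
    have "card U \<le> card ?R" using U R by (intro card_mono) auto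
    then show ?thesis using True by (simp add: U_def)
  next
    case False
    let ?u = "real (card U)"
    let ?S = "real (sum_list (map (\<lambda>A. card (A \<inter> U)) As))"
    have "real (sum_list (map (\<lambda>A. card (A \<inter> U) * (card (A \<inter> U) - 1)) As))
        = (\<Sum>x\<in>U. real (card {y\<in>U. covered As x y}))"
      by (simp only: sum_card_covered_Int[OF As(1) finA U(2), symmetric] of_nat_sum)
    also have "\<dots> \<le> (\<Sum>x\<in>U. c * ?n / real k)"
    proof (rule sum_mono)
      fix x assume "x \<in> U"
      have "card {y\<in>U. covered As x y} \<le> card {y \<in> ?R. covered As x y}"
        using U R by (intro card_mono) auto
      moreover have "real (card {y \<in> ?R. covered As x y}) < c * real (card ?R) / real k"
        using \<open>x \<in> U\<close> False by (auto simp: U_def stuck_def)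
      moreover have "c * real (card ?R) / real k \<le> c * ?n / real k"
        using pos R V by (intro divide_right_mono mult_left_mono of_nat_mono card_mono) auto
      ultimately show "real (card {y\<in>U. covered As x y}) \<le> c * ?n / real k" by linarith
    qed
    finally have up: "real (sum_list (map (\<lambda>A. card (A \<inter> U) * (card (A \<inter> U) - 1)) As)) \<le> ?u * (c * ?n / real k)"
      by simp
    have "m * ?u = (\<Sum>v\<in>U. m)" by simp
    also have "\<dots> \<le> (\<Sum>v\<in>U. real (dg As v))"
      by (intro sum_mono) (auto simp: U_def stuck_def)
    also have "\<dots> = ?S" by (simp only: sum_dg[OF U(2), symmetric] of_nat_sum)
    finally have S: "m * ?u \<le> ?S" .
    \<comment> \<open>The tangent is taken at S / t, the mean for t sets; having fewer sets only
      improves the bound.\<close>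
    have "?S ^ 2 / real t - ?S = (2 * (?S / real t) - 1) * ?S - (?S / real t) ^ 2 * real t"
      using pos by (simp add: field_simps power2_eq_square)
    also have "\<dots> \<le> (2 * (?S / real t) - 1) * ?S - (?S / real t) ^ 2 * real (length As)"
      using As(3) by (intro diff_left_mono mult_left_mono) auto
    also have "\<dots> \<le> ?u * (c * ?n / real k)"
      using sum_list_tangent[of "?S / real t" "\<lambda>A. card (A \<inter> U)" As] up by linarith
    finally have key: "?S ^ 2 / real t - ?S \<le> ?u * (c * ?n / real k)" .
    show ?thesis
    \<comment> \<open>If S < 2t, convexity says too little, but m u <= S and \<open>H1\<close>
      suffice. Otherwise the linear term S eats at most half of S^2 / t.\<close>
    proof (cases "?S < 2 * real t")
      case True
      then have "m * ?u \<le> m * (\<rho> * ?n)" using S H1 by (simp add: mult.assoc)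
      then show ?thesis using pos by (simp add: U_def)
    next
      case False
      then have "?S * (2 * real t) \<le> ?S * ?S" by (intro mult_left_mono) auto
      then have "?S ^ 2 / (2 * real t) \<le> ?S ^ 2 / real t - ?S"
        using pos by (simp add: field_simps power2_eq_square)
      then have "?S ^ 2 / (2 * real t) \<le> ?u * (c * ?n / real k)" using key by linarith
      moreover have "(m * ?u) ^ 2 / (2 * real t) \<le> ?S ^ 2 / (2 * real t)"
        using S pos by (intro divide_right_mono power_mono) auto
      ultimately have "(m * ?u) ^ 2 / (2 * real t) \<le> ?u * (c * ?n / real k)" by linarith
      then have "real k * m ^ 2 * (?u * ?u) \<le> 2 * real t * c * (?n * ?u)"
        using pos by (simp add: field_simps power2_eq_square)
      also have "\<dots> \<le> \<rho> * real k * m ^ 2 * (?n * ?u)"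
        by (intro mult_right_mono H2) auto
      finally have "(real k * m ^ 2 * ?u) * ?u \<le> (real k * m ^ 2 * ?u) * (\<rho> * ?n)"
        by (simp add: algebra_simps)
      then show ?thesis
      proof (cases "?u = 0")
        case True
        have "0 \<le> m * (\<rho> * ?n)" using H1 by (simp add: mult.assoc order_trans[of 0 "2 * real t"])
        then show ?thesis using True pos by (simp add: U_def zero_le_mult_iff)
      next
        case False
        then have "0 < real k * m ^ 2 * ?u" using pos by simp
        then show ?thesis
          using \<open>(real k * m ^ 2 * ?u) * ?u \<le> _\<close> unfolding U_def[symmetric]
          by (simp only: mult_le_cancel_left_pos)
      qed
    qed
  qed
qed

fun stuck_count :: "'a set \<Rightarrow> nat \<Rightarrow> 'a set list \<Rightarrow> real \<Rightarrow> real \<Rightarrow> real \<Rightarrow> 'a list \<Rightarrow> nat" where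
  "stuck_count V k As m \<rho> c [] = 0"
| "stuck_count V k As m \<rho> c (v # xs)
    = of_bool (stuck V k As m \<rho> c xs v) + stuck_count V k As m \<rho> c xs"

fun shrink_count :: "'a set \<Rightarrow> nat \<Rightarrow> 'a set list \<Rightarrow> real \<Rightarrow> real \<Rightarrow> real \<Rightarrow> 'a list \<Rightarrow> nat" where
  "shrink_count V k As m \<rho> c [] = 0"
| "shrink_count V k As m \<rho> c (v # xs)
    = of_bool (m < real (dg As v) \<and> \<not> stuck V k As m \<rho> c xs v) + shrink_count V k As m \<rho> c xs"

lemma length_eq_counts:
  "length xs = length (filter (\<lambda>v. real (dg As v) \<le> m) xs)
    + stuck_count V k As m \<rho> c xs + shrink_count V k As m \<rho> c xs"
  by (induction xs) (auto simp: stuck_def)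

text \<open>Independence makes every entry allowed at its turn. A counted entry removes a fraction
  of at least c / k of the allowed points, and does so only while more than \<rho> times
  \<open>card V\<close> remain; the + 1 is the last such removal.\<close>

lemma shrink_count_bounds:
  assumes V: "finite V" "V \<noteq> {}" and pos: "0 < c" "1 \<le> k" "0 < \<rho>" "\<rho> \<le> 1"
    and "set xs \<subseteq> V" "indep (covered As) (set xs)"
  shows "real (card (allowed V As xs)) \<le> real (card V) * exp (- (c * real (shrink_count V k As m \<rho> c xs) / real k))
    \<and> real (shrink_count V k As m \<rho> c xs) \<le> real k * ln (1 / \<rho>) / c + 1"
  using assms(7,8)
proof (induction xs)
  case Nil
  have "0 \<le> ln (1 / \<rho>)" using pos by (intro ln_ge_zero) simp
  then show ?case using pos by simp
next
  case (Cons v xs)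
  let ?R = "allowed V As xs" and ?p = "shrink_count V k As m \<rho> c xs" and ?n = "real (card V)"
  have n0: "0 < ?n" using V by (simp add: card_gt_0_iff)
  have R: "finite ?R" "card (allowed V As (v # xs)) \<le> card ?R"
    using V by (auto simp: allowed_def intro!: card_mono)
  have v: "v \<in> ?R"
    using Cons.prems covered_sym by (fastforce simp: allowed_def indep_def)
  have IH: "real (card ?R) \<le> ?n * exp (- (c * real ?p / real k))
      \<and> real ?p \<le> real k * ln (1 / \<rho>) / c + 1"
    using Cons by (auto simp: indep_def)
  show ?case
  proof (cases "m < real (dg As v) \<and> \<not> stuck V k As m \<rho> c xs v")
    case True
    let ?N = "{y \<in> ?R. covered As v y}"
    have big: "\<rho> * ?n < real (card ?R)" and nb: "c * real (card ?R) / real k \<le> real (card ?N)"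
      using True v by (auto simp: stuck_def)
    have Rp: "real (card ?R) \<le> ?n * exp (- (c * real ?p / real k))" using IH True by auto
    have "card (allowed V As (v # xs)) = card ?R - card ?N"
      unfolding allowed_Cons using R by (intro card_Diff_subset) auto
    moreover have "card ?N \<le> card ?R" using R by (intro card_mono) auto
    ultimately have "real (card (allowed V As (v # xs))) \<le> real (card ?R) * (1 + - (c / real k))"
      using nb by (simp add: algebra_simps)
    also have "\<dots> \<le> real (card ?R) * exp (- (c / real k))"
      by (intro mult_left_mono exp_ge_add_one_self) auto
    also have "\<dots> \<le> ?n * exp (- (c * real ?p / real k)) * exp (- (c / real k))"
      using Rp by (intro mult_right_mono) auto
    also have "\<dots> = ?n * exp (- (c * real (Suc ?p) / real k))"
      by (simp add: algebra_simps add_divide_distrib flip: exp_add)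
    finally have 1: "real (card (allowed V As (v # xs))) \<le> ?n * exp (- (c * real (Suc ?p) / real k))" .
    have "?n * \<rho> < ?n * exp (- (c * real ?p / real k))" using big Rp by (simp add: mult.commute)
    then have "\<rho> < exp (- (c * real ?p / real k))" using n0 by simp
    then have "ln \<rho> < - (c * real ?p / real k)" using pos(3) by (metis exp_gt_zero ln_exp ln_less_cancel_iff)
    then have "c * real ?p / real k < ln (1 / \<rho>)" using pos(3) by (simp add: ln_div)
    then have "real ?p \<le> real k * ln (1 / \<rho>) / c" using pos by (simp add: field_simps)
    then show ?thesis using 1 True by simp
  next
    case False
    then show ?thesis using IH R(2) by (auto intro: order_trans[of _ "real (card ?R)"])
  qed
qed

text \<open>A point is low while its degree is at most \<open>m\<close>; it can be hit at most \<open>m + 1\<close> times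
  in that state.\<close>

definition few_low :: "nat \<Rightarrow> 'a set list \<Rightarrow> real \<Rightarrow> 'a set \<Rightarrow> bool" where
  "few_low k As m A \<longleftrightarrow> 2 * card {v \<in> A. real (dg As v) \<le> m} \<le> k"

text \<open>Of the k points at most k/2 are low and at most k/8 + 1 <= k/4 shrink the allowed set,
  so at least k/4 are stuck. Weight z^16 on each of these gives z^(4 k), of which z^k pays for the
  factor 2^(k + 1).\<close>

lemma card_few_low_extensions_le:
  fixes z :: real
  assumes V: "finite V" "card V = n" and As: "packing_list As" "set As \<subseteq> ksets V k" "length As \<le> t"
    and pos: "0 < m" "8 \<le> k" "1 \<le> t" "2 * k ^ 2 \<le> n" and z: "4 \<le> z"
    and H1: "2 * real t * z ^ 16 \<le> m * real n"
    and H2: "256 * real t * ln z * z ^ 16 \<le> real k * m ^ 2"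
  shows "real (card {A \<in> ksets V k. packing_list (A # As) \<and> few_low k As m A}) * z ^ (3 * k) \<le> real (n choose k)"
proof -
  define \<rho> where "\<rho> = 1 / z ^ 16"
  \<comment> \<open>With this c the bound of \<open>shrink_count_bounds\<close> becomes k/8 +
    1.\<close>
  define c where "c = 8 * ln (1 / \<rho>)"
  have z0: "0 < z" and \<rho>: "0 < \<rho>" using z by (auto simp: \<rho>_def)
  have ln: "ln (1 / \<rho>) = 16 * ln z" using z0 by (simp add: \<rho>_def ln_realpow)
  have lnz: "0 < ln z" using z by simp
  have c: "c = 128 * ln z" by (simp add: c_def ln)
  have n0: "0 < n" using pos by (metis gr0I le_zero_eq mult_eq_0_iff power_eq_0_iff rel_simps(28) zero_neq_numeral)
  have V0: "V \<noteq> {}" using V n0 by auto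
  let ?F = "{A \<in> ksets V k. packing_list (A # As) \<and> few_low k As m A}"
  have fin: "finite (ksets V k)" using V(1) by (rule finite_ksets)
  define w where "w xs v = (if stuck V k As m \<rho> c xs v then z ^ 16 else 1)" for xs v
  have w_nonneg: "0 \<le> w xs v" for xs v using z0 by (simp add: w_def)
  have w_eq: "weight w xs = (z ^ 16) ^ stuck_count V k As m \<rho> c xs" for xs
    by (induction xs) (auto simp: w_def)
  have "fact k * (\<Sum>A\<in>ksets V k. of_bool (A \<in> ?F) * z ^ (4 * k)) \<le> (\<Sum>xs\<in>words V k. weight w xs)"
  proof (rule sum_ksets_le_words[OF V(1)])
    show "0 \<le> weight w xs" for xs by (intro weight_nonneg w_nonneg)
  next
    fix xs assume xs: "xs \<in> words V k" "distinct xs"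
    show "of_bool (set xs \<in> ?F) * z ^ (4 * k) \<le> weight w xs"
    proof (cases "set xs \<in> ?F")
      case True
      have ind: "indep (covered As) (set xs)"
        unfolding indep_def
      proof (intro ballI notI)
        fix x y assume xy: "x \<in> set xs" "y \<in> set xs" "covered As x y"
        then obtain B where B: "B \<in> set As" "x \<in> B" "y \<in> B" by (auto simp: covered_def)
        have "x = y" by (rule nearly_disjointD[of "set xs" B]) (use xy True B in auto)
        then show False using xy by (simp add: covered_def)
      qed
      have "length (filter (\<lambda>v. real (dg As v) \<le> m) xs) = card {v \<in> set xs. real (dg As v) \<le> m}"
        using distinct_card[OF distinct_filter[OF xs(2)]] by simp
      then have lo: "2 * length (filter (\<lambda>v. real (dg As v) \<le> m) xs) \<le> k"
        using True by (simp add: few_low_def)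
      have "real (shrink_count V k As m \<rho> c xs) \<le> real k * ln (1 / \<rho>) / c + 1"
        using shrink_count_bounds[OF V(1) V0, of c k \<rho> xs As m] ind xs(1) lnz \<rho> pos
        z by (auto simp: words_def c_def ln) (auto simp: \<rho>_def)
      also have "\<dots> = real k / 8 + 1" using lnz by (simp add: c_def ln)
      finally have "4 * shrink_count V k As m \<rho> c xs \<le> k" using pos(2) by linarith
      then have "k \<le> 4 * stuck_count V k As m \<rho> c xs"
        using lo length_eq_counts[of xs As m V k \<rho> c] xs(1) by (simp add: words_def)
      then have "z ^ (4 * k) \<le> z ^ (16 * stuck_count V k As m \<rho> c xs)"
        using z by (intro power_increasing) auto
      then show ?thesis using True by (simp add: w_eq power_mult)
    next
      case False
      then show ?thesis by (simp only: of_bool_eq simp_thms mult_zero_left weight_nonneg[OF w_nonneg])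
    qed
  qed
  also have "\<dots> \<le> (2 * real n) ^ k"
  proof (rule sum_weight_le[OF V(1) w_nonneg])
    fix xs
    have "card {v \<in> V. stuck V k As m \<rho> c xs v} \<le> \<rho> * real (card V)"
    proof (rule card_stuck_le[OF V(1) As(1) _ As(3)])
      show "\<forall>A\<in>set As. A \<subseteq> V" using As(2) by (auto simp: ksets_def)
      show "2 * real t \<le> m * \<rho> * real (card V)" using H1 z0 V(2) by (simp add: \<rho>_def field_simps)
      show "2 * real t * c \<le> \<rho> * real k * m ^ 2" using H2 z0 by (simp add: \<rho>_def c field_simps)
    qed (use pos lnz in \<open>auto simp: c_def ln\<close>)
    then have "real (card {v \<in> V. stuck V k As m \<rho> c xs v}) * z ^ 16 \<le> real n"
      using z0 V(2) by (simp add: \<rho>_def field_simps)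
    moreover have "(\<Sum>v\<in>V. w xs v) \<le> (\<Sum>v\<in>V. of_bool (stuck V k As m \<rho> c xs v) * z ^ 16 + 1)"
      using z0 by (intro sum_mono) (auto simp: w_def)
    moreover have "(\<Sum>v\<in>V. of_bool (stuck V k As m \<rho> c xs v) * z ^ 16 + 1)
        = real (card {v \<in> V. stuck V k As m \<rho> c xs v}) * z ^ 16 + real n"
      using V by (simp only: sum.distrib sum_distrib_right[symmetric] sum_of_bool_eq) (simp add: Int_def)
    ultimately show "(\<Sum>v\<in>V. w xs v) \<le> 2 * real n" by linarith
  qed simp
  also have "\<dots> = 2 ^ k * real n ^ k" by (simp add: power_mult_distrib)
  also have "\<dots> \<le> 2 ^ k * (2 * fact k * real (n choose k))"
    by (intro mult_left_mono power_le_fact_choose pos) simp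
  finally have "fact k * ((\<Sum>A\<in>ksets V k. of_bool (A \<in> ?F)) * z ^ (4 * k)) \<le> fact k * (2 ^ Suc k * real (n choose k))"
    by (simp add: sum_distrib_left sum_distrib_right algebra_simps)
  moreover have "(\<Sum>A\<in>ksets V k. of_bool (A \<in> ?F)) = real (card ?F)"
    using fin by (simp only: sum_of_bool_eq) (simp add: Int_def)
  ultimately have "real (card ?F) * z ^ (4 * k) \<le> 2 ^ Suc k * real (n choose k)" by simp
  also have "\<dots> \<le> z ^ k * real (n choose k)"
  proof (rule mult_right_mono)
    have "(2 :: real) ^ Suc k \<le> 2 ^ (2 * k)" using pos(2) by (intro power_increasing) auto
    also have "\<dots> = 4 ^ k" by (simp add: power_mult)
    also have "\<dots> \<le> z ^ k" using z by (intro power_mono) auto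
    finally show "2 ^ Suc k \<le> z ^ k" .
  qed simp
  finally have "real (card ?F) * z ^ (4 * k) \<le> z ^ k * real (n choose k)" .
  moreover have "z ^ (4 * k) = z ^ k * z ^ (3 * k)" by (simp flip: power_add)
  ultimately have "z ^ k * (real (card ?F) * z ^ (3 * k)) \<le> z ^ k * real (n choose k)"
    by (simp only: mult.left_commute)
  then show ?thesis using z0 by (simp only: mult_le_cancel_left_pos zero_less_power)
qed

section \<open>Dense bound for whole families\<close>

fun few_low_count :: "nat \<Rightarrow> real \<Rightarrow> 'a set list \<Rightarrow> nat" where
  "few_low_count k m [] = 0"
| "few_low_count k m (A # As) = of_bool (few_low k As m A) + few_low_count k m As"

text \<open>A set that is not \<open>few_low\<close> keeps more than k/2 points in the core.\<close>

lemma length_le_few_low_count: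
  "k * length As \<le> 2 * sum_list (map card (core m As)) + k * few_low_count k m As"
  by (induction As) (auto simp: few_low_def)

lemma sum_card_core_le:
  assumes "finite V" "\<forall>A\<in>set As. A \<subseteq> V" "0 \<le> m"
  shows "real (sum_list (map card (core m As))) \<le> real (card V) * (m + 1)"
proof -
  have "sum_list (map (\<lambda>B. card (B \<inter> V)) (core m As)) = sum_list (map card (core m As))"
  proof (intro arg_cong[of _ _ sum_list] map_cong refl)
    fix B assume "B \<in> set (core m As)"
    then have "B \<subseteq> V" using core_subset assms(2) by blast
    then show "card (B \<inter> V) = card B" by (simp add: Int_absorb2)
  qed
  then have "real (sum_list (map card (core m As))) = real (sum_list (map (\<lambda>B. card (B \<inter> V)) (core m As)))"
    by simp
  also have "\<dots> = (\<Sum>v\<in>V. real (dg (core m As) v))"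
    by (simp only: sum_dg[OF assms(1), symmetric] of_nat_sum)
  also have "\<dots> \<le> (\<Sum>v\<in>V. m + 1)" by (intro sum_mono dg_core_le assms(3))
  finally show ?thesis by simp
qed

text \<open>By \<open>H3\<close> the low incidences number at most k t / 4, so at least half of the
  sets are \<open>few_low\<close>, with weight z^(3 k) each. The remaining steps weigh 1, whence the
  factor 2 per step. The total z^(3 k t / 2) covers both 2^t and z^(k t).\<close>

lemma nb_packings_dense_le:
  fixes z :: real
  assumes V: "finite V" "card V = n"
    and pos: "0 < m" "8 \<le> k" "1 \<le> t" "2 * k ^ 2 \<le> n" and z: "4 \<le> z"
    and H1: "2 * real t * z ^ 16 \<le> m * real n"
    and H2: "256 * real t * ln z * z ^ 16 \<le> real k * m ^ 2"
    and H3: "4 * real n * (m + 1) \<le> real k * real t"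
  shows "real (nb_packings V k t) * z ^ (k * t) \<le> real (n choose k) ^ t"
proof -
  define w :: "'a set list \<Rightarrow> 'a set \<Rightarrow> real" where
    "w As A = of_bool (packing_list (A # As)) * (if few_low k As m A then z ^ (3 * k) else 1)" for As A
  have z0: "0 < z" using z by simp
  have w_nonneg: "0 \<le> w As A" for As A using z0 by (simp add: w_def)
  have fin: "finite (ksets V k)" using V(1) by (rule finite_ksets)
  have step: "(\<Sum>A\<in>ksets V k. w As A) \<le> 2 * real (n choose k)"
    if As: "set As \<subseteq> ksets V k" "length As < t" for As
  proof (cases "packing_list As")
    case True
    let ?F = "{A \<in> ksets V k. packing_list (A # As) \<and> few_low k As m A}"
    have "(\<Sum>A\<in>ksets V k. w As A)
        \<le> (\<Sum>A\<in>ksets V k. of_bool (packing_list (A # As) \<and> few_low k As m A) * z ^ (3 * k) + 1)"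
      using z0 by (intro sum_mono) (auto simp: w_def)
    also have "\<dots> = real (card ?F) * z ^ (3 * k) + real (n choose k)"
      using fin card_ksets[OF V(1), of k] V(2)
      by (simp only: sum.distrib sum_distrib_right[symmetric] sum_of_bool_eq) (simp add: Int_def)
    also have "\<dots> \<le> real (n choose k) + real (n choose k)"
      using As by (intro add_mono order.refl card_few_low_extensions_le[OF V True _ _ pos z H1 H2]) auto
    finally show ?thesis by simp
  next
    case False
    then show ?thesis by (simp add: w_def)
  qed
  have w_eq: "weight w As = (z ^ (3 * k)) ^ few_low_count k m As" if "packing_list As" for As
    using that by (induction As) (auto simp: w_def)
  have ge: "2 ^ t * z ^ (k * t) \<le> weight w As" if As: "As \<in> words (ksets V k) t" "packing_list As" for As
  proof -
    have "real (sum_list (map card (core m As))) \<le> real (card V) * (m + 1)"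
      using As V pos by (intro sum_card_core_le) (auto simp: words_def ksets_def)
    then have "4 * real (sum_list (map card (core m As))) \<le> real (k * t)" using H3 V(2) by simp
    then have "4 * sum_list (map card (core m As)) \<le> k * t" by linarith
    moreover have "k * t \<le> 2 * sum_list (map card (core m As)) + k * few_low_count k m As"
      using length_le_few_low_count[of k As m] As(1) by (simp add: words_def)
    ultimately have "k * t \<le> 2 * (k * few_low_count k m As)" by linarith
    moreover have "8 * t \<le> k * t" using pos by simp
    ultimately have "k * t + t \<le> 3 * (k * few_low_count k m As)" by linarith
    then have "z ^ (k * t + t) \<le> z ^ (3 * (k * few_low_count k m As))"
      using z by (intro power_increasing) auto
    also have "\<dots> = weight w As" unfolding w_eq[OF As(2)] by (simp add: mult.assoc flip: power_mult)
    finally have "z ^ (k * t) * z ^ t \<le> weight w As" by (simp add: power_add)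
    moreover have "z ^ (k * t) * 2 ^ t \<le> z ^ (k * t) * z ^ t"
      using z by (intro mult_left_mono power_mono) auto
    ultimately show ?thesis by (simp add: mult.commute)
  qed
  let ?P = "{As \<in> words (ksets V k) t. packing_list As}"
  have "real (nb_packings V k t) * (2 ^ t * z ^ (k * t)) = (\<Sum>As\<in>?P. 2 ^ t * z ^ (k * t))"
    by (simp add: nb_packings_def)
  also have "\<dots> \<le> (\<Sum>As\<in>?P. weight w As)"
    using ge by (intro sum_mono) auto
  also have "\<dots> \<le> (\<Sum>As\<in>words (ksets V k) t. weight w As)"
    using finite_words[OF fin] by (intro sum_mono2) (auto intro: weight_nonneg w_nonneg)
  also have "\<dots> \<le> (2 * real (n choose k)) ^ t"
    using step by (intro sum_weight_le fin w_nonneg) auto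
  finally have "2 ^ t * (real (nb_packings V k t) * z ^ (k * t)) \<le> 2 ^ t * real (n choose k) ^ t"
    by (simp only: power_mult_distrib mult.left_commute)
  then show ?thesis by (simp only: mult_le_cancel_left_pos zero_less_power zero_less_numeral)
qed

lemma packing_list_pairs_le:
  assumes "finite V" "As \<in> words (ksets V k) t" "packing_list As"
  shows "t * (k * (k - 1)) \<le> card V * card V"
proof -
  have As: "length As = t" "\<forall>A\<in>set As. A \<subseteq> V \<and> finite A \<and> card A = k"
    using assms by (auto simp: words_def ksets_def intro: finite_subset)
  have "sum_list (map (\<lambda>A. card (A \<inter> V) * (card (A \<inter> V) - 1)) As) = sum_list (map (\<lambda>A. k * (k - 1)) As)"
    using As(2) by (intro arg_cong[of _ _ sum_list] map_cong refl) (simp add: Int_absorb2)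
  also have "\<dots> = t * (k * (k - 1))" using As(1) by (simp add: sum_list_triv)
  finally have "t * (k * (k - 1)) = (\<Sum>x\<in>V. card {y\<in>V. covered As x y})"
    using sum_card_covered_Int[OF assms(3) _ assms(1)] As(2) by simp
  also have "\<dots> \<le> (\<Sum>x\<in>V. card V)" using assms(1) by (intro sum_mono card_mono) auto
  finally show ?thesis by simp
qed

lemma packing_ratio_dense_le:
  fixes z :: real
  assumes "4 \<le> z" "8 \<le> k" "2 * k ^ 2 \<le> n" and t: "real t = z ^ 64 * real n ^ 2 / real k ^ 3"
  shows "packing_ratio n k t \<le> 1 / z ^ (k * t)"
proof (cases "z ^ 64 \<le> 2 * real k")
  case True
  have z0: "0 < z" and k0: "0 < real k" using assms by auto
  have "0 < 2 * k ^ 2" using assms(2) by simp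
  then have n0: "0 < real n" using assms(3) by linarith
  have zp: "4 ^ j \<le> z ^ j" for j using assms(1) by (intro power_mono) auto
  have "0 < real t" unfolding t using z0 k0 n0 by simp
  then have t1: "1 \<le> t" by simp
  have kn: "k \<le> n" using assms(3) by (metis le_trans le_square mult_2 power2_eq_square trans_le_add1)
  \<comment> \<open>This is t k / n divided by z^16. \<open>H3\<close> needs m well below t k / n,
    while \<open>H1\<close> and \<open>H2\<close> need it large; the case assumption z^64 <= 2k
    serves \<open>H1\<close>.\<close>
  define m where "m = z ^ 48 * real n / real k ^ 2"
  have m0: "0 < m" using z0 n0 k0 by (simp add: m_def)
  have "k ^ 2 \<le> n" using assms(3) by linarith
  then have k2n: "real k ^ 2 \<le> real n" by (simp flip: of_nat_power)
  have "1 * real k ^ 2 \<le> z ^ 48 * real n"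
    using k2n z0 one_le_power[of z 48] assms(1) by (intro mult_mono) auto
  then have m1: "1 \<le> m" using k0 by (simp add: m_def)
  have H1: "2 * real t * z ^ 16 \<le> m * real n"
  proof -
    have "4 * z ^ 32 \<le> z ^ 32 * z ^ 32" using zp[of 32] by (intro mult_right_mono) auto
    also have "\<dots> \<le> 2 * real k" using True by (simp flip: power_add)
    finally have "z ^ 48 * real n ^ 2 / real k ^ 3 * (2 * z ^ 32) \<le> z ^ 48 * real n ^ 2 / real k ^ 3 * real k"
      using z0 by (intro mult_left_mono) auto
    moreover have "z ^ 48 * real n ^ 2 / real k ^ 3 * (2 * z ^ 32) = 2 * real t * z ^ 16"
      unfolding t by (simp flip: power_add)
    moreover have "z ^ 48 * real n ^ 2 / real k ^ 3 * real k = m * real n"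
      using k0 by (simp add: m_def power2_eq_square power3_eq_cube)
    ultimately show ?thesis by simp
  qed
  have H2: "256 * real t * ln z * z ^ 16 \<le> real k * m ^ 2"
  proof -
    have "256 * ln z \<le> z ^ 15 * z"
      using zp[of 15] z0 ln_le_minus_one[OF z0] assms(1) by (intro mult_mono) auto
    then have "z ^ 80 * real n ^ 2 / real k ^ 3 * (256 * ln z) \<le> z ^ 80 * real n ^ 2 / real k ^ 3 * z ^ 16"
      using z0 by (intro mult_left_mono) (auto simp flip: power_Suc2)
    moreover have "z ^ 80 * real n ^ 2 / real k ^ 3 * (256 * ln z) = 256 * real t * ln z * z ^ 16"
      unfolding t by (simp flip: power_add)
    moreover have "z ^ 80 * real n ^ 2 / real k ^ 3 * z ^ 16 = real k * m ^ 2"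
      using k0 power_Suc[of "real k" 3]
      by (simp add: m_def power_divide power_mult_distrib field_simps flip: power_add power_mult)
    ultimately show ?thesis by simp
  qed
  have H3: "4 * real n * (m + 1) \<le> real k * real t"
  proof -
    have "4 * real n * (m + 1) \<le> 4 * real n * (2 * m)" using m1 by (intro mult_left_mono) auto
    also have "\<dots> = z ^ 48 * real n ^ 2 / real k ^ 2 * 8"
      by (simp add: m_def power2_eq_square)
    also have "\<dots> \<le> z ^ 48 * real n ^ 2 / real k ^ 2 * z ^ 16"
      using z0 zp[of 16] by (intro mult_left_mono) auto
    also have "\<dots> = real k * real t"
      unfolding t using k0 by (simp add: power2_eq_square power3_eq_cube flip: power_add)
    finally show ?thesis .
  qed
  have "real (nb_packings {1..n} k t) * z ^ (k * t) \<le> real (n choose k) ^ t"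
    using assms m0 t1 H1 H2 H3 by (intro nb_packings_dense_le[where m = m]) auto
  then show ?thesis using z0 kn by (simp add: packing_ratio_def field_simps)
next
  case False
  \<comment> \<open>Here t k (k - 1) >= t k^2 / 2 = z^64 n^2 / (2 k) > n^2, more ordered pairs than
    there are.\<close>
  have "{As \<in> words (ksets {1..n} k) t. packing_list As} = {}"
  proof (intro equals0I)
    fix As assume "As \<in> {As \<in> words (ksets {1..n} k) t. packing_list As}"
    then have "t * (k * (k - 1)) \<le> n * n"
      using packing_list_pairs_le[of "{1..n}" As k t] by simp
    then have "real (t * (k * (k - 1))) \<le> real (n * n)" by (rule of_nat_mono)
    then have "real t * (real k * (real k - 1)) \<le> real n ^ 2"
      using assms(2) by (simp add: of_nat_diff power2_eq_square)
    moreover have "real t * (real k * (real k / 2)) \<le> real t * (real k * (real k - 1))"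
      using assms(2) by (intro mult_left_mono) auto
    ultimately have "real t * real k ^ 2 \<le> 2 * real n ^ 2"
      by (simp add: power2_eq_square)
    then have "z ^ 64 * real n ^ 2 / real k \<le> 2 * real n ^ 2"
      unfolding t using assms(2) by (simp add: power2_eq_square power3_eq_cube)
    then have "z ^ 64 * real n ^ 2 \<le> (2 * real k) * real n ^ 2"
      using assms(2) by (simp add: field_simps)
    moreover have "0 < 2 * k ^ 2" using assms(2) by simp
    then have "0 < n" using assms(3) by linarith
    then have "0 < real n ^ 2" by simp
    ultimately show False using False by (simp only: mult_le_cancel_right_pos)
  qed
  then have "nb_packings {1..n} k t = 0" unfolding nb_packings_def by (simp only: card.empty)
  then show ?thesis using assms(1) by (simp add: packing_ratio_def)
qed

section \<open>Asymptotics\<close>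

text \<open>For \<open>D\<close> above the range of the sparse estimate, only an initial segment of the family is
  used, of length about \<open>\<delta> n\<^sup>2 / k\<^sup>3\<close>.\<close>

lemma packing_ratio_bounded_density_le:
  fixes D\<^sub>0 :: real
  assumes "1 \<le> D\<^sub>0"
  obtains \<beta> where "0 < \<beta>" and
    "\<And>c. 0 < c \<Longrightarrow> \<exists>K. \<forall>n k t D. K \<le> real k \<longrightarrow> K * real k ^ 2 \<le> real n \<longrightarrow>
       real t = D * real n ^ 2 / real k ^ 3 \<longrightarrow> c \<le> D \<longrightarrow> D \<le> D\<^sub>0 \<longrightarrow>
       packing_ratio n k t \<le> exp (- (\<beta> * D * real t * real k))"
proof -
  \<comment> \<open>Chosen so that 1 - 24 \<epsilon> = 1/2.\<close>
  define \<epsilon> :: real where "\<epsilon> = 1 / 48"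
  define \<delta> where "\<delta> = \<epsilon> / (4 * exp 1) powr (1 / \<epsilon>)"
  \<comment> \<open>The first entry serves D <= \<delta>, the second D between \<delta> and the
    upper limit. Neither involves c, which only enters \<open>K\<close>: in the theorem \<beta> is
    fixed before D is known.\<close>
  define \<beta> where "\<beta> = min (1 / 8) (\<delta> ^ 2 / (32 * D\<^sub>0 ^ 2))"
  have \<epsilon>: "0 < \<epsilon>" "\<epsilon> \<le> 1" by (auto simp: \<epsilon>_def)
  have \<delta>: "0 < \<delta>" by (simp add: \<delta>_def \<epsilon>_def)
  have \<beta>: "0 < \<beta>" using \<delta> assms by (simp add: \<beta>_def)
  have "\<exists>K. \<forall>n k t D. K \<le> real k \<longrightarrow> K * real k ^ 2 \<le> real n \<longrightarrow>
       real t = D * real n ^ 2 / real k ^ 3 \<longrightarrow> c \<le> D \<longrightarrow> D \<le> D\<^sub>0 \<longrightarrow>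
       packing_ratio n k t \<le> exp (- (\<beta> * D * real t * real k))" if c: "0 < c" for c
  proof -
    \<comment> \<open>Since k <= n^2 / k^3, the entry with c gives t >= 48 = 1 / \<epsilon>. The
      entry with \<delta> gives y >= 96, so that rounding y down loses less than half of it.\<close>
    define K where "K = max (max 48 (8 / \<epsilon> ^ 3)) (max (48 / c) (96 / \<delta>))"
    have "packing_ratio n k t \<le> exp (- (\<beta> * D * real t * real k))"
      if k: "K \<le> real k" and n: "K * real k ^ 2 \<le> real n"
        and t: "real t = D * real n ^ 2 / real k ^ 3" and D: "c \<le> D" "D \<le> D\<^sub>0" for n k t :: nat and D
    proof -
      have K: "8 / \<epsilon> ^ 3 \<le> real k" "48 \<le> real k" "48 / c \<le> real k" "96 / \<delta> \<le> real k"
        using k by (auto simp: K_def)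
      have "48 * real k ^ 2 \<le> K * real k ^ 2" by (intro mult_right_mono) (auto simp: K_def)
      then have n48: "48 * real k ^ 2 \<le> real n" using n by linarith
      have k0: "0 < real k" using K by linarith
      have n0: "0 < real n" using n48 k0 by (metis less_le_trans mult_pos_pos zero_less_numeral zero_less_power)
      have k2n: "2 * k ^ 2 \<le> n"
      proof -
        have "real (2 * k ^ 2) \<le> real n" using n48 zero_le_power2[of "real k"] by simp
        then show ?thesis by (simp only: of_nat_le_iff)
      qed
      have kY: "real k \<le> real n ^ 2 / real k ^ 3"
      proof -
        have "real k ^ 2 \<le> real n" using n48 zero_le_power2[of "real k"] by linarith
        then have "(real k ^ 2) ^ 2 \<le> real n ^ 2" by (intro power_mono) auto
        then show ?thesis using k0 by (simp add: field_simps eval_nat_numeral)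
      qed
      have main: "packing_ratio n k t' \<le> exp (- (real t' ^ 2 * real k ^ 4 / (8 * real n ^ 2)))"
        if "48 \<le> real t'" "real t' \<le> \<delta> * (real n ^ 2 / real k ^ 3)" for t'
      proof -
        have "packing_ratio n k t' \<le> exp (- ((1 - 24 * \<epsilon>) * (real t' ^ 2 * real k ^ 4 / (4 * real n ^ 2))))"
        proof (rule packing_ratio_le[OF \<epsilon>])
          show "real t' * real k ^ 3 \<le> \<epsilon> / (4 * exp 1) powr (1 / \<epsilon>) * real n ^ 2"
            unfolding \<delta>_def[symmetric] using that(2) k0 by (simp add: field_simps)
        qed (use that K k2n n48 in \<open>auto simp: \<epsilon>_def\<close>)
        also have "(1 - 24 * \<epsilon>) * (real t' ^ 2 * real k ^ 4 / (4 * real n ^ 2)) = real t' ^ 2 * real k ^ 4 / (8 * real n ^ 2)"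
          by (simp add: \<epsilon>_def)
        finally show ?thesis .
      qed
      define a where "a = real n ^ 2 / real k ^ 2"
      have a0: "0 < a" using k0 n0 by (simp add: a_def)
      have tk: "real t * real k = D * a"
        unfolding t a_def using k0 by (simp add: power2_eq_square power3_eq_cube)
      have D0: "0 < D" using c D by linarith
      show ?thesis
      proof (cases "D \<le> \<delta>")
        case True
        have "48 \<le> c * real k" using K(3) c by (simp add: field_simps)
        also have "\<dots> \<le> D * (real n ^ 2 / real k ^ 3)" using D c kY by (intro mult_mono) auto
        finally have "48 \<le> real t" by (simp add: t)
        moreover have "real t \<le> \<delta> * (real n ^ 2 / real k ^ 3)"
          unfolding t using mult_right_mono[OF True, of "real n ^ 2 / real k ^ 3"] by simp
        ultimately have "packing_ratio n k t \<le> exp (- (real t ^ 2 * real k ^ 4 / (8 * real n ^ 2)))"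
          by (rule main)
        also have "real t ^ 2 * real k ^ 4 / (8 * real n ^ 2) = (real t * real k) * (real t * real k) / (8 * a)"
          using k0 n0 by (simp add: a_def field_simps eval_nat_numeral)
        also have "\<dots> = 1 / 8 * (D * (D * a))" using a0 by (simp add: tk)
        finally have "packing_ratio n k t \<le> exp (- (1 / 8 * (D * (D * a))))" .
        also have "\<dots> \<le> exp (- (\<beta> * (D * (D * a))))"
        proof -
          have "\<beta> * (D * (D * a)) \<le> 1 / 8 * (D * (D * a))"
            using D0 a0 by (intro mult_right_mono) (auto simp: \<beta>_def)
          then show ?thesis by simp
        qed
        finally show ?thesis by (simp add: tk mult.assoc)
      next
        case False
        define y where "y = \<delta> * (real n ^ 2 / real k ^ 3)"
        define t' where "t' = nat \<lfloor>y\<rfloor>"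
        have "96 \<le> \<delta> * real k" using K(4) \<delta> by (simp add: field_simps)
        also have "\<dots> \<le> y" unfolding y_def using \<delta> kY by (intro mult_left_mono) auto
        finally have y: "96 \<le> y" .
        then have t': "real t' \<le> y" "y - 1 \<le> real t'" unfolding t'_def by linarith+
        have "y \<le> real t"
          unfolding y_def t using False mult_right_mono[of \<delta> D "real n ^ 2 / real k ^ 3"] by simp
        then have "t' \<le> t" using t'(1) by linarith
        then have "packing_ratio n k t \<le> packing_ratio n k t'" by (rule packing_ratio_antimono)
        also have "\<dots> \<le> exp (- (real t' ^ 2 * real k ^ 4 / (8 * real n ^ 2)))"
          using t' y by (intro main) (auto simp: y_def)
        also have "\<dots> \<le> exp (- (\<beta> * (D * (D * a))))"
        proof -
          have "(y / 2) ^ 2 \<le> real t' ^ 2" using t' y by (intro power_mono) auto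
          then have "(y / 2) ^ 2 * real k ^ 4 / (8 * real n ^ 2) \<le> real t' ^ 2 * real k ^ 4 / (8 * real n ^ 2)"
            by (intro divide_right_mono mult_right_mono) auto
          moreover have "(y / 2) ^ 2 * real k ^ 4 / (8 * real n ^ 2) = \<delta> ^ 2 / 32 * a"
            unfolding y_def a_def using k0 n0 by (simp add: field_simps eval_nat_numeral)
          moreover have "\<beta> * (D * (D * a)) \<le> \<delta> ^ 2 / 32 * a"
          proof -
            have "\<beta> * (D * (D * a)) \<le> \<delta> ^ 2 / (32 * D\<^sub>0 ^ 2) * (D\<^sub>0 * (D\<^sub>0 * a))"
              using D D0 a0 \<beta> assms by (intro mult_mono) (auto simp: \<beta>_def)
            also have "\<dots> = \<delta> ^ 2 / 32 * a" using assms by (simp add: power2_eq_square)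
            finally show ?thesis .
          qed
          ultimately show ?thesis by simp
        qed
        finally show ?thesis by (simp add: tk mult.assoc)
      qed
    qed
    then show ?thesis by blast
  qed
  with \<beta> show ?thesis by (rule that)
qed

section \<open>From explicit bounds to Landau hypotheses\<close>

lemma eventually_k_ge:
  fixes k :: "nat \<Rightarrow> nat"
  assumes "(\<lambda>_. 1) \<in> o(\<lambda>n. real (k n))"
  shows "\<forall>\<^sub>F n in sequentially. C \<le> real (k n)"
proof -
  have "\<forall>\<^sub>F n in sequentially. norm (1 :: real) \<le> 1 / (\<bar>C\<bar> + 1) * norm (real (k n))"
    by (rule landau_o.smallD[OF assms]) simp
  then show ?thesis by eventually_elim (simp add: field_simps)
qed

lemma eventually_k2_le:
  fixes k :: "nat \<Rightarrow> nat"
  assumes "(\<lambda>n. real (k n)) \<in> o(\<lambda>n. sqrt (real n))"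
  shows "\<forall>\<^sub>F n in sequentially. C * real (k n) ^ 2 \<le> real n"
proof -
  define B where "B = \<bar>C\<bar> + 1"
  have B: "0 < B" "C \<le> B" by (auto simp: B_def)
  have "\<forall>\<^sub>F n in sequentially. norm (real (k n)) \<le> 1 / sqrt B * norm (sqrt (real n))"
    by (rule landau_o.smallD[OF assms]) (use B in simp)
  then show ?thesis
  proof eventually_elim
    case (elim n)
    then have "sqrt B * real (k n) \<le> sqrt (real n)" using B by (simp add: field_simps)
    then have "(sqrt B * real (k n)) ^ 2 \<le> sqrt (real n) ^ 2" using B by (intro power_mono) auto
    then have "B * real (k n) ^ 2 \<le> real n" using B by (simp add: power_mult_distrib)
    moreover have "C * real (k n) ^ 2 \<le> B * real (k n) ^ 2" using B by (intro mult_right_mono) auto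
    ultimately show ?case by linarith
  qed
qed

lemma zeta_le_dense:
  shows "\<exists>\<beta>::real. \<beta> > 0 \<and>
           (\<forall>(k :: nat \<Rightarrow> nat) (t :: nat \<Rightarrow> nat) (D :: nat \<Rightarrow> real).
              (\<lambda>_. 1) \<in> o(\<lambda>n. real (k n)) \<longrightarrow>
              (\<lambda>n. real (k n)) \<in> o(\<lambda>n. sqrt (real n)) \<longrightarrow>
              (\<forall>\<^sub>F n in sequentially. real (t n) = D n * real n ^ 2 / real (k n) ^ 3) \<longrightarrow>
              D \<in> \<Omega>(\<lambda>_. 1) \<longrightarrow>
              (\<forall>\<^sub>F n in sequentially.
                 zeta n (k n) (t n) <
                   (if D n \<le> exp 1
                    then exp (- (\<beta> * D n * real (t n) * real (k n)))
                    else exp (- (\<beta> * ln (D n) * real (t n) * real (k n))))))"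
proof -
  obtain \<beta>\<^sub>0 where \<beta>\<^sub>0: "0 < \<beta>\<^sub>0" and bounded: "\<And>c. 0 < c \<Longrightarrow> \<exists>K. \<forall>n k t D. K \<le> real k \<longrightarrow> K * real k ^ 2 \<le> real n \<longrightarrow>
       real t = D * real n ^ 2 / real k ^ 3 \<longrightarrow> c \<le> D \<longrightarrow> D \<le> 4 ^ 64 \<longrightarrow>
       packing_ratio n k t \<le> exp (- (\<beta>\<^sub>0 * D * real t * real k))"
    by (rule packing_ratio_bounded_density_le[of "4 ^ 64"]) auto
  \<comment> \<open>The split at D = 4^64 makes z = D^(1/64) at least 4 above it, and 1/64 is the
    resulting factor of ln D. Halving makes the inequalities strict.\<close>
  define \<beta> where "\<beta> = min (1 / 64) \<beta>\<^sub>0 / 2"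
  have \<beta>: "0 < \<beta>" "\<beta> < 1 / 64" "\<beta> < \<beta>\<^sub>0" using \<beta>\<^sub>0 by (auto simp: \<beta>_def min_def)
  show ?thesis
  proof (intro exI[of _ \<beta>] conjI \<beta>(1) allI impI)
    fix k t :: "nat \<Rightarrow> nat" and D :: "nat \<Rightarrow> real"
    assume k: "(\<lambda>_. 1) \<in> o(\<lambda>n. real (k n))" "(\<lambda>n. real (k n)) \<in> o(\<lambda>n. sqrt (real n))"
      and t: "\<forall>\<^sub>F n in sequentially. real (t n) = D n * real n ^ 2 / real (k n) ^ 3"
      and D: "D \<in> \<Omega>(\<lambda>_. 1)"
    obtain c where c: "0 < c" "\<forall>\<^sub>F n in sequentially. c * norm (1 :: real) \<le> norm (D n)"
      using D by (elim landau_omega.bigE)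
    obtain K where K: "\<forall>n k t D. K \<le> real k \<longrightarrow> K * real k ^ 2 \<le> real n \<longrightarrow>
       real t = D * real n ^ 2 / real k ^ 3 \<longrightarrow> c \<le> D \<longrightarrow> D \<le> 4 ^ 64 \<longrightarrow>
       packing_ratio n k t \<le> exp (- (\<beta>\<^sub>0 * D * real t * real k))"
      using bounded[OF c(1)] by blast
    define K' where "K' = max K 8"
    show "\<forall>\<^sub>F n in sequentially. zeta n (k n) (t n) <
                   (if D n \<le> exp 1
                    then exp (- (\<beta> * D n * real (t n) * real (k n)))
                    else exp (- (\<beta> * ln (D n) * real (t n) * real (k n))))"
      using t c(2) eventually_k_ge[OF k(1), of K'] eventually_k2_le[OF k(2), of K']
    proof eventually_elim
      case (elim n)
      let ?k = "real (k n)" and ?t = "real (t n)"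
      have K': "K \<le> ?k" "8 \<le> ?k" using elim(3) by (auto simp: K'_def)
      have "K * ?k ^ 2 \<le> K' * ?k ^ 2" "8 * ?k ^ 2 \<le> K' * ?k ^ 2"
        by (intro mult_right_mono; simp add: K'_def)+
      moreover have "K' * ?k ^ 2 \<le> real n" using elim(4) by (simp add: K'_def)
      ultimately have n: "K * ?k ^ 2 \<le> real n" "8 * ?k ^ 2 \<le> real n" by linarith+
      have k0: "0 < ?k" using K' by linarith
      have n0: "0 < real n" using n k0 by (metis less_le_trans mult_pos_pos zero_less_numeral zero_less_power)
      have k2n: "2 * k n ^ 2 \<le> n"
      proof -
        have "real (2 * k n ^ 2) \<le> real n" using n(2) zero_le_power2[of ?k] by simp
        then show ?thesis by (simp only: of_nat_le_iff)
      qed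
      then have kn: "k n \<le> n" by (metis le_trans le_square mult_2 power2_eq_square trans_le_add1)
      \<comment> \<open>The Omega hypothesis bounds only the absolute value of D; its sign comes
        from t >= 0.\<close>
      have "0 \<le> D n"
      proof (rule ccontr)
        assume "\<not> 0 \<le> D n"
        then have "D n * (real n ^ 2 / ?k ^ 3) < 0" using n0 k0 by (intro mult_neg_pos) auto
        then show False using elim(1) by simp
      qed
      then have D: "c \<le> D n" "0 < D n" using elim(2) c(1) by auto
      have tk: "0 < ?t * ?k" unfolding elim(1) using D n0 k0 by simp
      have zeta: "zeta n (k n) (t n) \<le> packing_ratio n (k n) (t n)"
        by (rule zeta_le_packing_ratio[OF kn])
      show ?case
      proof (cases "D n \<le> 4 ^ 64")
        case True
        have "packing_ratio n (k n) (t n) \<le> exp (- (\<beta>\<^sub>0 * D n * ?t * ?k))"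
          using K K'(1) n(1) elim(1) D(1) True by blast
        also have "\<dots> < exp (- (\<beta> * D n * ?t * ?k))"
        proof -
          have "\<beta> * (D n * (?t * ?k)) < \<beta>\<^sub>0 * (D n * (?t * ?k))"
            using \<beta>(3) D(2) tk by (intro mult_strict_right_mono) auto
          then show ?thesis by (simp add: mult.assoc)
        qed
        finally have 1: "zeta n (k n) (t n) < exp (- (\<beta> * D n * ?t * ?k))" using zeta by linarith
        \<comment> \<open>D may lie on either side of e here; the bound with D implies the one with
          ln D.\<close>
        have "ln (D n) \<le> D n" using ln_le_minus_one[OF D(2)] by linarith
        then have "\<beta> * (ln (D n) * (?t * ?k)) \<le> \<beta> * (D n * (?t * ?k))"
          using \<beta>(1) tk by (intro mult_left_mono mult_right_mono) auto
        then have "exp (- (\<beta> * D n * ?t * ?k)) \<le> exp (- (\<beta> * ln (D n) * ?t * ?k))"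
          by (simp add: mult.assoc)
        with 1 have "zeta n (k n) (t n) < exp (- (\<beta> * ln (D n) * ?t * ?k))" by (rule less_le_trans)
        then show ?thesis using 1 by simp
      next
        case False
        define z where "z = D n powr (1 / 64)"
        have z0: "0 < z" using D by (simp add: z_def)
        have z64: "z ^ 64 = D n" using D by (simp add: z_def powr_powr flip: powr_realpow)
        have z4: "4 \<le> z" using False z0 unfolding z64[symmetric] by (meson linorder_not_le power_mono less_imp_le)
        have "packing_ratio n (k n) (t n) \<le> 1 / z ^ (k n * t n)"
          using z4 K' k2n elim(1) by (intro packing_ratio_dense_le) (auto simp: z64)
        also have "\<dots> = exp (- (1 / 64 * (ln (D n) * (?t * ?k))))"
        proof -
          have "ln z = ln (D n) / 64" using D by (simp add: z_def ln_powr)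
          moreover have "z ^ (k n * t n) = exp (real (k n * t n) * ln z)"
            using z0 by (simp only: exp_of_nat_mult exp_ln)
          ultimately show ?thesis by (simp add: exp_minus field_simps)
        qed
        also have "\<dots> < exp (- (\<beta> * (ln (D n) * (?t * ?k))))"
        proof -
          have "1 < D n" using False by (metis linorder_not_le order_trans one_le_numeral one_le_power)
          then have "0 < ln (D n) * (?t * ?k)" using tk by simp
          with \<beta>(2) have "\<beta> * (ln (D n) * (?t * ?k)) < 1 / 64 * (ln (D n) * (?t * ?k))"
            by (rule mult_strict_right_mono)
          then show ?thesis by simp
        qed
        finally have "zeta n (k n) (t n) < exp (- (\<beta> * ln (D n) * ?t * ?k))"
          using zeta by (simp add: mult.assoc)
        moreover have "exp 1 < (4 :: real) ^ 64"
        proof -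
          have "exp 1 \<le> (3 :: real)" by (rule exp_le)
          also have "\<dots> < 4 ^ 64" by simp
          finally show ?thesis .
        qed
        ultimately show ?thesis using False by auto
      qed
    qed
  qed
qed

lemma zeta_le_sparse:
  fixes k t :: "nat \<Rightarrow> nat"
  assumes k: "(\<lambda>_. 1) \<in> o(\<lambda>n. real (k n))" "(\<lambda>n. real (k n)) \<in> o(\<lambda>n. sqrt (real n))"
    and t: "(\<lambda>_. 1) \<in> o(\<lambda>n. real (t n))" "(\<lambda>n. real (t n)) \<in> o(\<lambda>n. real n ^ 2 / real (k n) ^ 3)"
  shows "\<exists>\<epsilon> :: nat \<Rightarrow> real. \<epsilon> \<in> o(\<lambda>_. 1) \<and>
                 (\<forall>\<^sub>F n in sequentially.
                    zeta n (k n) (t n) <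
                      exp (- ((1 - \<epsilon> n) * (real (t n) ^ 2 * real (k n) ^ 4 / (4 * real n ^ 2)))))"
proof -
  define X where "X n = real (t n) ^ 2 * real (k n) ^ 4 / (4 * real n ^ 2)" for n
  define Z where "Z n = zeta n (k n) (t n)" for n
  have Z_nonneg: "0 \<le> Z n" for n by (simp add: Z_def zeta_def)
  have X_pos: "\<forall>\<^sub>F n in sequentially. 0 < X n"
    using eventually_k_ge[OF k(1), of 1] eventually_k_ge[OF t(1), of 1] eventually_gt_at_top[of 0]
    by eventually_elim (simp add: X_def)
  have small: "\<forall>\<^sub>F n in sequentially. Z n \<le> exp (- ((1 - \<eta>) * X n))" if \<eta>: "0 < \<eta>" "\<eta> \<le> 1" for \<eta>
  proof -
    define \<epsilon> where "\<epsilon> = \<eta> / 24"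
    define \<delta> where "\<delta> = \<epsilon> / (4 * exp 1) powr (1 / \<epsilon>)"
    have \<epsilon>: "0 < \<epsilon>" "\<epsilon> \<le> 1" using \<eta> by (auto simp: \<epsilon>_def)
    have \<delta>: "0 < \<delta>" using \<epsilon> by (simp add: \<delta>_def)
    have "\<forall>\<^sub>F n in sequentially. norm (real (t n)) \<le> \<delta> * norm (real n ^ 2 / real (k n) ^ 3)"
      by (rule landau_o.smallD[OF t(2) \<delta>])
    then show ?thesis
      using eventually_k_ge[OF k(1), of "8 / \<epsilon> ^ 3"]
        eventually_k_ge[OF t(1), of "1 / \<epsilon>"] eventually_k2_le[OF k(2), of 2]
        eventually_k2_le[OF k(2), of "1 / \<epsilon>"]
    proof eventually_elim
      case (elim n)
      have k0: "0 < real (k n)" using elim(2) \<epsilon>(1) less_le_trans[of 0 "8 / \<epsilon> ^ 3" "real (k n)"] by simp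
      have "2 * real (k n) ^ 2 \<le> real n" using elim(4) by simp
      then have "real (2 * k n ^ 2) \<le> real n" by simp
      then have k2n: "2 * k n ^ 2 \<le> n" by (simp only: of_nat_le_iff)
      then have kn: "k n \<le> n" by (metis le_trans le_square mult_2 power2_eq_square trans_le_add1)
      have "Z n \<le> packing_ratio n (k n) (t n)"
        unfolding Z_def by (rule zeta_le_packing_ratio[OF kn])
      also have "\<dots> \<le> exp (- ((1 - 24 * \<epsilon>) * (real (t n) ^ 2 * real (k n) ^ 4 / (4 * real n ^ 2))))"
      proof (rule packing_ratio_le[OF \<epsilon> elim(3) elim(2) k2n])
        show "real (k n) ^ 2 \<le> \<epsilon> * real n" using elim(5) \<epsilon> by (simp add: field_simps)
        show "real (t n) * real (k n) ^ 3 \<le> \<epsilon> / (4 * exp 1) powr (1 / \<epsilon>) * real n ^ 2"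
          unfolding \<delta>_def[symmetric] using elim(1) k0 by (simp add: field_simps)
      qed
      finally show ?case by (simp add: \<epsilon>_def X_def)
    qed
  qed
  \<comment> \<open>Solving Z = exp (- (1 - \<epsilon>) X) for \<epsilon> gives 1 + ln Z / X, so
    \<open>small\<close> for each fixed \<eta> suffices and no diagonal sequence is needed. The case
    Z = 0 is apart because \<open>ln 0 = 0\<close> would give 1, and 1 / n makes the inequality
    strict.\<close>
  define \<epsilon> where "\<epsilon> n = max 0 (if Z n = 0 then 0 else 1 + ln (Z n) / X n) + 1 / real n" for n
  show ?thesis
  proof (intro exI[of _ \<epsilon>] conjI)
    show "\<epsilon> \<in> o(\<lambda>_. 1)"
    proof (rule landau_o.smallI)
      fix c :: real assume c: "0 < c"
      define \<eta> where "\<eta> = min 1 (c / 2)"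
      have \<eta>: "0 < \<eta>" "\<eta> \<le> 1" "\<eta> \<le> c / 2" using c by (auto simp: \<eta>_def)
      have "(\<lambda>n. 1 / real n) \<longlonglongrightarrow> 0" by (rule lim_1_over_n)
      then have "\<forall>\<^sub>F n in sequentially. 1 / real n < c / 2" using c by (intro order_tendstoD) auto
      then show "\<forall>\<^sub>F n in sequentially. norm (\<epsilon> n) \<le> c * norm (1 :: real)"
        using small[OF \<eta>(1,2)] X_pos
      proof eventually_elim
        case (elim n)
        have "(if Z n = 0 then 0 else 1 + ln (Z n) / X n) \<le> \<eta>"
        proof (cases "Z n = 0")
          case False
          then have "0 < Z n" using Z_nonneg[of n] by linarith
          then have "ln (Z n) \<le> - ((1 - \<eta>) * X n)"
            using elim(2) by (metis exp_gt_zero ln_exp ln_le_cancel_iff)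
          then have "ln (Z n) / X n \<le> - (1 - \<eta>)"
            using elim(3) by (simp only: pos_divide_le_eq mult_minus_left)
          then show ?thesis using False by simp
        qed (use \<eta> in simp)
        then have "max 0 (if Z n = 0 then 0 else 1 + ln (Z n) / X n) \<le> \<eta>" using \<eta> by simp
        then have "\<epsilon> n \<le> \<eta> + 1 / real n" unfolding \<epsilon>_def by (rule add_right_mono)
        then have "\<epsilon> n \<le> c" using elim(1) \<eta>(3) by linarith
        moreover have "0 \<le> \<epsilon> n" unfolding \<epsilon>_def by simp
        ultimately show ?case by simp
      qed
    qed
    show "\<forall>\<^sub>F n in sequentially. zeta n (k n) (t n) <
        exp (- ((1 - \<epsilon> n) * (real (t n) ^ 2 * real (k n) ^ 4 / (4 * real n ^ 2))))"
      using X_pos eventually_gt_at_top[of 0]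
    proof eventually_elim
      case (elim n)
      have "Z n < exp (- ((1 - \<epsilon> n) * X n))"
      proof (cases "Z n = 0")
        case False
        then have Z: "0 < Z n" using Z_nonneg[of n] by linarith
        have "1 + ln (Z n) / X n \<le> max 0 (1 + ln (Z n) / X n)" by simp
        moreover have "0 < 1 / real n" using elim(2) by simp
        moreover have "\<epsilon> n = max 0 (1 + ln (Z n) / X n) + 1 / real n" using False by (simp add: \<epsilon>_def)
        ultimately have "1 + ln (Z n) / X n < \<epsilon> n" by linarith
        then have "ln (Z n) / X n < - (1 - \<epsilon> n)" by simp
        then have "ln (Z n) < - (1 - \<epsilon> n) * X n" using elim(1) by (simp only: pos_divide_less_eq)
        then have "exp (ln (Z n)) < exp (- ((1 - \<epsilon> n) * X n))"
          by (simp only: exp_less_cancel_iff mult_minus_left)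
        then show ?thesis using Z by simp
      qed simp
      then show ?case by (simp add: Z_def X_def)
    qed
  qed
qed

theorem theorem1p5:
  shows "(\<exists>\<beta>::real. \<beta> > 0 \<and>
           (\<forall>(k :: nat \<Rightarrow> nat) (t :: nat \<Rightarrow> nat) (D :: nat \<Rightarrow> real).
              (\<lambda>_. 1) \<in> o(\<lambda>n. real (k n)) \<longrightarrow>
              (\<lambda>n. real (k n)) \<in> o(\<lambda>n. sqrt (real n)) \<longrightarrow>
              (\<forall>\<^sub>F n in sequentially. real (t n) = D n * real n ^ 2 / real (k n) ^ 3) \<longrightarrow>
              D \<in> \<Omega>(\<lambda>_. 1) \<longrightarrow>
              (\<forall>\<^sub>F n in sequentially.
                 zeta n (k n) (t n) <
                   (if D n \<le> exp 1
                    then exp (- (\<beta> * D n * real (t n) * real (k n)))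
                    else exp (- (\<beta> * ln (D n) * real (t n) * real (k n)))))))
       \<and> (\<forall>(k :: nat \<Rightarrow> nat) (t :: nat \<Rightarrow> nat).
              (\<lambda>_. 1) \<in> o(\<lambda>n. real (k n)) \<longrightarrow>
              (\<lambda>n. real (k n)) \<in> o(\<lambda>n. sqrt (real n)) \<longrightarrow>
              (\<lambda>_. 1) \<in> o(\<lambda>n. real (t n)) \<longrightarrow>
              (\<lambda>n. real (t n)) \<in> o(\<lambda>n. real n ^ 2 / real (k n) ^ 3) \<longrightarrow>
              (\<exists>\<epsilon> :: nat \<Rightarrow> real. \<epsilon> \<in> o(\<lambda>_. 1) \<and>
                 (\<forall>\<^sub>F n in sequentially.
                    zeta n (k n) (t n) <
                      exp (- ((1 - \<epsilon> n) * (real (t n) ^ 2 * real (k n) ^ 4 / (4 * real n ^ 2)))))))"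
proof (intro conjI allI impI, goal_cases)
  case 1
  show ?case by (rule zeta_le_dense)
next
  case (2 k t)
  then show ?case by (rule zeta_le_sparse)
qed

end
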